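(* Let $N$ be a nontrivial torsion-free, finitely generated nilpotent group with a finite generating subset $S$. There exists a $k \in \mathbb{N}$ such that $$n \preceq \mathrm{Sub}_{N,S}(n) \preceq n^{k}.$$
   Context: $\mathbb{N}=\{1,2,\dots\}$. For a group $G$ with finite generating subset $S$, $\|g\|_S$ denotes the word length of $g\in G$ with respect to $S$. For a finite subset $X\subseteq G$, $\|X\|_S=\max\{\|x\|_S : x\in X\}$, and for a finitely generated subgroup $H\le G$, $\|H\|_S=\min\{\|X\|_S : X \text{ is a finite generating subset for } H\}$. For a group $G$, a proper subgroup $H$ and $g \in G\setminus H$, set $\mathrm{D}_G(H,g) = \min\{|Q| : Q \text{ is a finite group and there is a group morphism } \pi: G\to Q \text{ with } \pi(g)\notin\pi(H)\}$, with value $\infty$ if no such $Q$ exists. $G$ is subgroup separable if $\mathrm{D}_G(H,g)<\infty$ for every finitely generated subgroup $H$ and every $g\in G\setminus H$. For a finitely generated subgroup separable group $G$ (finitely generated nilpotent groups are subgroup separable), set $\mathrm{Sub}_{G,S}(n)=\max\{\mathrm{D}_G(H,g) : H\le G \text{ finitely generated},\ g\in G\setminus H,\ \|H\|_S\le n,\ \|g\|_S\le n\}$ for $n\in\mathbb{N}$. For non-decreasing functions $f,g$ on $\mathbb{N}$, $f(n)\preceq g(n)$ means there is $C\in\mathbb{N}$ with $f(n)\le C\,g(Cn)$ for all $n$. *)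

theory Defs
  imports "HOL-Algebra.Generated_Groups" "HOL-Library.Extended_Nat"
begin

subsection \<open>Torsion-free and nilpotent groups\<close>

definition torsion_free :: "('a, 'b) monoid_scheme \<Rightarrow> bool" where
  "torsion_free G \<longleftrightarrow>
     (\<forall>x\<in>carrier G. x \<noteq> \<one>\<^bsub>G\<^esub> \<longrightarrow> (\<forall>n::nat. n > 0 \<longrightarrow> x [^]\<^bsub>G\<^esub> n \<noteq> \<one>\<^bsub>G\<^esub>))"

text \<open>
  Indexing starts at \<open>0\<close> with the whole group. The library's \<open>derived_set\<close> only covers
  commutators of a set with itself.
\<close>

primrec lower_central_series :: "('a, 'b) monoid_scheme \<Rightarrow> nat \<Rightarrow> 'a set" where
  "lower_central_series G 0 = carrier G"
| "lower_central_series G (Suc i) =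
     generate G {x \<otimes>\<^bsub>G\<^esub> y \<otimes>\<^bsub>G\<^esub> inv\<^bsub>G\<^esub> x \<otimes>\<^bsub>G\<^esub> inv\<^bsub>G\<^esub> y | x y.
                   x \<in> lower_central_series G i \<and> y \<in> carrier G}"

definition nilpotent_group :: "('a, 'b) monoid_scheme \<Rightarrow> bool" where
  "nilpotent_group G \<longleftrightarrow> group G \<and> (\<exists>c. lower_central_series G c = {\<one>\<^bsub>G\<^esub>})"

subsection \<open>Word length\<close>

definition finite_generating_set :: "('a, 'b) monoid_scheme \<Rightarrow> 'a set \<Rightarrow> 'a set \<Rightarrow> bool" where
  "finite_generating_set G H X \<longleftrightarrow> finite X \<and> X \<subseteq> carrier G \<and> generate G X = H"

definition fg_subgroup :: "('a, 'b) monoid_scheme \<Rightarrow> 'a set \<Rightarrow> bool" where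
  "fg_subgroup G H \<longleftrightarrow> subgroup H G \<and> (\<exists>X. finite_generating_set G H X)"

text \<open>The three \<open>LEAST\<close>-style quantities below are only meaningful when \<open>S\<close> generates \<open>G\<close>
  and, for the last one, when \<open>H\<close> is finitely generated.\<close>

definition word_length :: "('a, 'b) monoid_scheme \<Rightarrow> 'a set \<Rightarrow> 'a \<Rightarrow> nat" where
  "word_length G S g =
     (LEAST n. \<exists>w. length w = n \<and> set w \<subseteq> S \<union> m_inv G ` S \<and>
                   foldr (\<lambda>x y. x \<otimes>\<^bsub>G\<^esub> y) w \<one>\<^bsub>G\<^esub> = g)"

text \<open>Inserting \<open>0\<close> gives the empty set length \<open>0\<close> and changes nothing for nonempty sets.\<close>

definition set_length :: "('a, 'b) monoid_scheme \<Rightarrow> 'a set \<Rightarrow> 'a set \<Rightarrow> nat" where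
  "set_length G S X = Max (insert 0 (word_length G S ` X))"

definition subgroup_length :: "('a, 'b) monoid_scheme \<Rightarrow> 'a set \<Rightarrow> 'a set \<Rightarrow> nat" where
  "subgroup_length G S H =
     (LEAST n. \<exists>X. finite_generating_set G H X \<and> set_length G S X = n)"

subsection \<open>Separating a subgroup from an element\<close>

text \<open>
  Finite quotients are taken with carriers in \<^typ>\<open>nat\<close>; by the lemma \<open>D_sep_le\<close> below every finite
  group is accounted for. The infimum of a nonempty set in \<^typ>\<open>enat\<close> is attained, and the
  infimum of the empty set is \<open>\<infinity>\<close>.
\<close>

definition D_sep :: "('a, 'b) monoid_scheme \<Rightarrow> 'a set \<Rightarrow> 'a \<Rightarrow> enat" where
  "D_sep G H g =
     Inf {enat (card (carrier Q)) | Q :: nat monoid.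
            group Q \<and> finite (carrier Q) \<and> (\<exists>\<pi>\<in>hom G Q. \<pi> g \<notin> \<pi> ` H)}"

lemma D_sep_le:
  fixes Q :: "('c, 'd) monoid_scheme"
  assumes "group G" "subgroup H G" "g \<in> carrier G"
    and "group Q" "finite (carrier Q)" "\<pi> \<in> hom G Q" "\<pi> g \<notin> \<pi> ` H"
  shows "D_sep G H g \<le> enat (card (carrier Q))"
proof -
  interpret Q: group Q by fact
  obtain f where f: "bij_betw f (carrier Q) {0..<card (carrier Q)}"
    using ex_bij_betw_finite_nat[OF assms(5)] by blast
  define h where "h = inv_into (carrier Q) f"
  define R :: "nat monoid" where
    "R = \<lparr>carrier = {0..<card (carrier Q)}, mult = (\<lambda>a b. f (h a \<otimes>\<^bsub>Q\<^esub> h b)), one = f \<one>\<^bsub>Q\<^esub>\<rparr>"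
  have hf: "h (f x) = x" if "x \<in> carrier Q" for x
    using f that by (simp add: h_def bij_betw_inv_into_left)
  have iso: "f \<in> iso Q R"
    using f by (auto simp: iso_def hom_def R_def hf dest: bij_betwE)
  have one: "f \<one>\<^bsub>Q\<^esub> = \<one>\<^bsub>R\<^esub>" by (simp add: R_def)
  have R: "group R"
  proof -
    have "group (R\<lparr>one := f \<one>\<^bsub>Q\<^esub>\<rparr>)" by (rule Q.iso_imp_img_group[OF iso])
    then show ?thesis by (simp add: R_def)
  qed
  have inj: "inj_on f (carrier Q)" using f by (simp add: bij_betw_def)
  have car: "\<pi> x \<in> carrier Q" if "x \<in> carrier G" for x
    using assms(6) that by (auto simp: hom_def)
  have "(f \<circ> \<pi>) \<in> hom G R"
    using assms(6) iso by (auto simp: iso_def hom_def Pi_iff)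
  moreover have "(f \<circ> \<pi>) g \<notin> (f \<circ> \<pi>) ` H"
    proof
    assume "(f \<circ> \<pi>) g \<in> (f \<circ> \<pi>) ` H"
    then obtain x where x: "x \<in> H" "f (\<pi> g) = f (\<pi> x)" by auto
    then have "\<pi> g = \<pi> x"
      using inj_onD[OF inj] car assms(3) subgroup.mem_carrier[OF assms(2)] by blast
    with x(1) assms(7) show False by blast
  qed
  moreover have "finite (carrier R)" "card (carrier R) = card (carrier Q)"
    by (simp_all add: R_def)
  ultimately show ?thesis
    unfolding D_sep_def using R by (intro Inf_lower) (simp, intro exI[of _ R] conjI bexI[of _ "f \<circ> \<pi>"], simp_all)
qed

subsection \<open>Growth functions\<close>

text \<open>
  A supremum in \<^typ>\<open>enat\<close>: it is the maximum whenever it is finite and the set is nonempty, and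
  a finite upper bound for it includes the assertion that all values are finite.
\<close>

definition Sub :: "('a, 'b) monoid_scheme \<Rightarrow> 'a set \<Rightarrow> nat \<Rightarrow> enat" where
  "Sub G S n =
     Sup {D_sep G H g | H g. fg_subgroup G H \<and> g \<in> carrier G - H \<and>
                         subgroup_length G S H \<le> n \<and> word_length G S g \<le> n}"

lemma mono_Sub: "mono (Sub G S)"
  unfolding mono_def Sub_def by (intro allI impI Sup_subset_mono) fastforce

text \<open>The relation is meant for non-decreasing functions on the positive integers; values at \<open>0\<close>
  are ignored.\<close>

definition growth_le :: "(nat \<Rightarrow> enat) \<Rightarrow> (nat \<Rightarrow> enat) \<Rightarrow> bool" (infix "\<preceq>" 50) where
  "f \<preceq> g \<longleftrightarrow> (\<exists>C\<ge>1. \<forall>n\<ge>1. f n \<le> enat C * g (C * n))"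

end

theory Submission
  imports Defs "HOL-Algebra.Multiplicative_Group" "HOL-Computational_Algebra.Primes"
begin

text \<open>
  The lower bound only needs an element \<open>s\<close> of infinite order: a finite quotient in which the image
  of \<open>s\<^bsup>2^k\<^esup>\<close> is not a power of the image of \<open>s\<^bsup>2^(k+1)\<^esup>\<close> has order at least \<open>2^(k+1)\<close>
  (\<open>two_power_le_D_sep\<close>).

  For the upper bound, refining the lower central series gives elements \<open>a\<^sub>1, \<dots>, a\<^sub>h\<close> such
  that the subgroups \<open>N\<^sub>i = \<langle>a\<^sub>i, \<dots>, a\<^sub>h\<rangle>\<close> form a central series
  (\<open>nilpotent_central_seq\<close>). The quotient of \<open>N\<close> by the normal subgroup generated by all \<open>e\<close>-th
  powers has order at most \<open>e\<^sup>h\<close> (\<open>power_subgroup_transversal\<close>), so it suffices to find, for a subgroup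
  \<open>H\<close> generated by elements of length at most \<open>n\<close> and \<open>g \<notin> H\<close> of length at most \<open>n\<close>, an
  exponent \<open>e\<close> of polynomial size with \<open>g \<notin> V\<^sub>e(N) H\<close>, where \<open>V\<^sub>e\<close> is generated by the
  \<open>e\<close>-th powers (\<open>separation_polybounded\<close>).

  This is proved by induction along the series. Write \<open>N = \<langle>a, M\<rangle>\<close> with \<open>M\<close> the next term. Three
  facts make the induction work. Collection shows that words of length \<open>n\<close> have the form
  \<open>a\<^sup>j y\<close> with \<open>\<bar>j\<bar> \<le> n\<close> and \<open>y\<close> of polynomial length in \<open>M\<close>
  (\<open>collect_polybounded\<close>). The exponents of \<open>a\<close> occurring in \<open>H\<close> are the multiples of some \<open>m\<close>,
  which bounded Bezout coefficients realise by an element \<open>u\<close> of \<open>H\<close> of polynomial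
  length (\<open>leading_element_polybounded\<close>). And \<open>H \<inter> M\<close> is again generated by elements of polynomial
  length, because finitely many iterated commutators with \<open>u\<close> replace the infinitely many
  conjugates by powers of \<open>u\<close> (\<open>intersection_polybounded\<close>).

  If the exponent of \<open>g\<close> is not a multiple of \<open>m\<close>, the cyclic quotient \<open>N / M\<close> separates \<open>g\<close> from
  \<open>H\<close>. Otherwise dividing by a power of \<open>u\<close> moves \<open>g\<close> into \<open>M\<close>, where some exponent \<open>e\<close>
  separates it from \<open>H \<inter> M\<close>. Modulo \<open>V\<^sub>e(M)\<close> the element \<open>u\<^sup>t\<close> with \<open>t\<close> a fixed power of \<open>e\<close>
  commutes with \<open>M\<close> by nilpotency, whence \<open>V\<^sub>m\<^sub>t\<^sub>e(N)\<close> lies in \<open>V\<^sub>e(M) \<langle>u\<^sup>t\<rangle>\<close>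
  (\<open>power_subgroup_extension\<close>). Since \<open>u\<close> is in \<open>H\<close>, the exponent \<open>m t e\<close> separates \<open>g\<close>
  from \<open>H\<close>. If \<open>m = 0\<close>, then \<open>a\<close> takes the place of \<open>u\<close> in this last step.
\<close>

section \<open>Polynomially bounded functions\<close>

definition polybounded :: "(nat \<Rightarrow> nat) \<Rightarrow> bool" where
  "polybounded p \<longleftrightarrow> (\<exists>C k. \<forall>n. p n \<le> C * (n + 1) ^ k)"

lemma polyboundedI: "(\<And>n. p n \<le> C * (n + 1) ^ k) \<Longrightarrow> polybounded p"
  unfolding polybounded_def by blast

lemma polybounded_const: "polybounded (\<lambda>_. c)"
  by (rule polyboundedI[of _ c 0]) simp

lemma polybounded_id: "polybounded (\<lambda>n. n)"
  by (rule polyboundedI[of _ 1 1]) simp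

lemma polybounded_add:
  assumes "polybounded p" "polybounded q"
  shows "polybounded (\<lambda>n. p n + q n)"
proof -
  obtain C k where p: "\<And>n. p n \<le> C * (n + 1) ^ k" using assms(1) polybounded_def by auto
  obtain D l where q: "\<And>n. q n \<le> D * (n + 1) ^ l" using assms(2) polybounded_def by auto
  show ?thesis
  proof (rule polyboundedI)
    fix n :: nat
    have "C * (n + 1) ^ k \<le> C * (n + 1) ^ (k + l)" "D * (n + 1) ^ l \<le> D * (n + 1) ^ (k + l)"
      by (intro mult_le_mono2 power_increasing; simp)+
    then show "p n + q n \<le> (C + D) * (n + 1) ^ (k + l)"
      using p[of n] q[of n] by (simp only: add_mult_distrib)
  qed
qed

lemma polybounded_mult:
  assumes "polybounded p" "polybounded q"
  shows "polybounded (\<lambda>n. p n * q n)"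
proof -
  obtain C k where p: "\<And>n. p n \<le> C * (n + 1) ^ k" using assms(1) polybounded_def by auto
  obtain D l where q: "\<And>n. q n \<le> D * (n + 1) ^ l" using assms(2) polybounded_def by auto
  show ?thesis
  proof (rule polyboundedI)
    fix n :: nat
    show "p n * q n \<le> (C * D) * (n + 1) ^ (k + l)"
      using mult_le_mono[OF p[of n] q[of n]] by (simp only: power_add mult_ac)
  qed
qed

lemma polybounded_power: "polybounded p \<Longrightarrow> polybounded (\<lambda>n. p n ^ d)"
  by (induction d) (auto intro: polybounded_const polybounded_mult)

lemma polybounded_compose:
  assumes "polybounded p" "polybounded q"
  shows "polybounded (\<lambda>n. p (q n))"
proof -
  obtain C k where p: "\<And>n. p n \<le> C * (n + 1) ^ k" using assms(1) polybounded_def by auto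
  have "polybounded (\<lambda>n. C * (q n + 1) ^ k)"
    by (intro polybounded_mult polybounded_power polybounded_add polybounded_const assms)
  then obtain D l where "\<And>n. C * (q n + 1) ^ k \<le> D * (n + 1) ^ l"
    unfolding polybounded_def by blast
  then show ?thesis using p by (blast intro: polyboundedI le_trans)
qed

lemmas polybounded_intros =
  polybounded_const polybounded_id polybounded_add polybounded_mult polybounded_power

lemma polybounded_mono:
  assumes "polybounded p"
  obtains q where "polybounded q" "mono q" "\<And>n. p n \<le> q n"
proof -
  obtain C k where p: "\<And>n. p n \<le> C * (n + 1) ^ k" using assms(1) polybounded_def by auto
  have "mono (\<lambda>n. C * (n + 1) ^ k)"
    by (intro monoI mult_le_mono2 power_mono) auto
  then show ?thesis
    using that[of "\<lambda>n. C * (n + 1) ^ k"] p by (blast intro: polyboundedI)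
qed

section \<open>Bezout coefficients of polynomial size\<close>

lemma int_subgroup_principal:
  fixes E :: "int set"
  assumes zero: "0 \<in> E" and diff: "\<And>x y. x \<in> E \<Longrightarrow> y \<in> E \<Longrightarrow> x - y \<in> E"
  obtains m where "m \<ge> 0" "m \<in> E" "\<And>x. x \<in> E \<Longrightarrow> m dvd x"
proof (cases "\<exists>x\<in>E. x > 0")
  case False
  have "x = 0" if "x \<in> E" for x
    using False diff[OF zero that] that by (cases x "0::int" rule: linorder_cases) force+
  then show ?thesis using that[of 0] zero by auto
next
  case True
  define P where "P n \<longleftrightarrow> n > 0 \<and> int n \<in> E" for n
  have "\<exists>n. P n" using True unfolding P_def by (metis zero_less_imp_eq_int)
  then have P: "P (LEAST n. P n)" by (rule LeastI_ex)
  define m where "m = int (LEAST n. P n)"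
  have m: "m > 0" "m \<in> E" using P by (auto simp: P_def m_def)
  have neg: "- x \<in> E" if "x \<in> E" for x using diff[OF zero that] by simp
  have add: "x + y \<in> E" if "x \<in> E" "y \<in> E" for x y
    using diff[OF that(1) neg[OF that(2)]] by simp
  have nat_mult: "m * int k \<in> E" for k
    by (induction k) (auto simp: zero distrib_left m add)
  have mult: "m * k \<in> E" for k
    using nat_mult[of "nat k"] neg[OF nat_mult[of "nat (- k)"]] by (cases "k \<ge> 0") auto
  have "m dvd x" if "x \<in> E" for x
  proof (rule ccontr)
    assume "\<not> m dvd x"
    then have "x mod m > 0" "x mod m < m"
      using m pos_mod_sign[of m x] pos_mod_bound[of m x] by (auto simp: dvd_eq_mod_eq_0 order_less_le)
    moreover have "x mod m \<in> E"
      using diff[OF that mult[of "x div m"]] by (simp add: minus_mult_div_eq_mod)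
    ultimately have "P (nat (x mod m))" "nat (x mod m) < (LEAST n. P n)"
      by (auto simp: P_def m_def)
    then show False using not_less_Least by blast
  qed
  then show ?thesis using that[of m] m by auto
qed

text \<open>
  All coefficients but one are reduced modulo a fixed nonzero element of \<open>V\<close>; the remaining one is
  then determined by the equation and hence small as well.
\<close>

lemma bezout_bounded:
  fixes V :: "int set"
  assumes V: "V \<subseteq> {- B..B}" and B: "B \<ge> 1"
  obtains m c where "m \<ge> 0" "m \<le> B" "\<And>v. v \<in> V \<Longrightarrow> m dvd v" "(\<Sum>v\<in>V. c v * v) = m"
    "\<And>v. v \<in> V \<Longrightarrow> \<bar>c v\<bar> \<le> 4 * B ^ 3"
proof -
  have fin: "finite V" using V finite_subset by blast
  define E where "E = range (\<lambda>c. \<Sum>v\<in>V. c v * v)"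
  have "0 \<in> E" unfolding E_def by (rule range_eqI[of _ _ "\<lambda>_. 0"]) simp
  moreover have "x - y \<in> E" if xy: "x \<in> E" "y \<in> E" for x y
  proof -
    obtain c d where "x = (\<Sum>v\<in>V. c v * v)" "y = (\<Sum>v\<in>V. d v * v)" using xy unfolding E_def by auto
    then have "x - y = (\<Sum>v\<in>V. (c v - d v) * v)" by (simp add: sum_subtractf left_diff_distrib)
    then show ?thesis unfolding E_def by (rule range_eqI[of _ _ "\<lambda>v. c v - d v"])
  qed
  ultimately obtain m where m: "m \<ge> 0" "m \<in> E" "\<And>x. x \<in> E \<Longrightarrow> m dvd x"
    using int_subgroup_principal[of E] by metis
  have "v \<in> E" if "v \<in> V" for v
  proof -
    have "(\<Sum>w\<in>V. (if w = v then 1 else 0) * w) = v"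
      using that fin by (simp add: if_distrib[of "\<lambda>c. c * _"] sum.delta cong: if_cong)
    then show ?thesis
      unfolding E_def by (intro range_eqI[of _ _ "\<lambda>w. if w = v then 1 else 0"]) (rule sym)
  qed
  then have dvd: "m dvd v" if "v \<in> V" for v using m(3) that by blast
  obtain c where c: "m = (\<Sum>v\<in>V. c v * v)" using m(2) unfolding E_def by auto
  show ?thesis
  proof (cases "V \<subseteq> {0}")
    case True
    then have "(\<Sum>v\<in>V. c v * v) = 0" by (intro sum.neutral) auto
    then show ?thesis using that[of 0 "\<lambda>_. 0"] True B c dvd by auto
  next
    case False
    then obtain w where w: "w \<in> V" "w \<noteq> 0" by auto
    have V_le: "\<bar>v\<bar> \<le> B" if "v \<in> V" for v using subsetD[OF V that] by auto
    then have wB: "\<bar>w\<bar> \<le> B" using w by blast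
    have mB: "m \<le> B" using dvd_imp_le_int[OF w(2) dvd[OF w(1)]] m(1) wB by linarith
    define d where "d v = (if v = w then c w + (\<Sum>u\<in>V - {w}. (c u div w) * u) else c v mod w)" for v
    have "(\<Sum>v\<in>V. d v * v) = d w * w + (\<Sum>v\<in>V - {w}. d v * v)"
      using fin w by (simp add: sum.remove)
    also have "(\<Sum>v\<in>V - {w}. d v * v) = (\<Sum>v\<in>V - {w}. c v * v - (c v div w) * v * w)"
      by (intro sum.cong refl) (auto simp: d_def minus_mult_div_eq_mod[symmetric] algebra_simps)
    also have "\<dots> = (\<Sum>v\<in>V - {w}. c v * v) - (\<Sum>u\<in>V - {w}. (c u div w) * u) * w"
      by (simp add: sum_subtractf sum_distrib_right)
    also have "d w * w + \<dots> = c w * w + (\<Sum>v\<in>V - {w}. c v * v)"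
      by (simp add: d_def algebra_simps)
    also have "\<dots> = m" using fin w c by (simp add: sum.remove)
    finally have dm: "(\<Sum>v\<in>V. d v * v) = m" .
    have small: "\<bar>d v\<bar> \<le> B" if "v \<noteq> w" for v
    proof -
      have "\<bar>c v mod w\<bar> \<le> \<bar>w\<bar>" using abs_mod_less[OF w(2), of "c v"] by linarith
      then show ?thesis using that wB by (simp add: d_def)
    qed
    have "card (V - {w}) \<le> card {- B..B}"
      using V by (intro card_mono) auto
    then have card: "int (card (V - {w})) \<le> 2 * B + 1" using B by simp
    have "\<bar>\<Sum>v\<in>V - {w}. d v * v\<bar> \<le> (\<Sum>v\<in>V - {w}. \<bar>d v * v\<bar>)" by (rule sum_abs)
    also have "\<dots> \<le> (\<Sum>v\<in>V - {w}. B * B)"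
    proof (intro sum_mono)
      fix v assume v: "v \<in> V - {w}"
      then have "\<bar>v\<bar> \<le> B" using V_le by blast
      then show "\<bar>d v * v\<bar> \<le> B * B"
        using small[of v] v B by (simp add: abs_mult mult_mono)
    qed
    also have "\<dots> = int (card (V - {w})) * (B * B)" by simp
    also have "\<dots> \<le> (2 * B + 1) * (B * B)" using card by (intro mult_right_mono) auto
    finally have rest: "\<bar>\<Sum>v\<in>V - {w}. d v * v\<bar> \<le> (2 * B + 1) * (B * B)" .
    have "d w * w = m - (\<Sum>v\<in>V - {w}. d v * v)"
      using dm fin w by (simp add: sum.remove)
    then have "\<bar>d w * w\<bar> \<le> B + (2 * B + 1) * (B * B)" using rest m(1) mB by linarith
    moreover have "\<bar>d w\<bar> * 1 \<le> \<bar>d w\<bar> * \<bar>w\<bar>" using w(2) by (intro mult_left_mono) auto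
    moreover have "B \<le> B * B" "B * B \<le> B * (B * B)" using B by auto
    ultimately have "\<bar>d w\<bar> \<le> 4 * B ^ 3"
      by (simp add: abs_mult power3_eq_cube distrib_right mult.assoc)
    moreover have "B \<le> 4 * B ^ 3"
      using \<open>B \<le> B * B\<close> \<open>B * B \<le> B * (B * B)\<close> B by (simp only: power3_eq_cube mult.assoc)
    ultimately have "\<bar>d v\<bar> \<le> 4 * B ^ 3" for v
      using small[of v] by (cases "v = w") auto
    then show ?thesis using that[of m d] m(1) mB dvd dm by blast
  qed
qed

section \<open>Balls in the word metric\<close>

text \<open>
  Balls take the place of word lengths because membership in them composes without side conditions:
  a least word length is only meaningful for elements of the subgroup generated by \<open>T\<close>.
\<close>

primrec ball :: "('a, 'b) monoid_scheme \<Rightarrow> 'a set \<Rightarrow> nat \<Rightarrow> 'a set" where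
  "ball G T 0 = {\<one>\<^bsub>G\<^esub>}"
| "ball G T (Suc n) =
     ball G T n \<union> {t \<otimes>\<^bsub>G\<^esub> x | t x. t \<in> T \<union> m_inv G ` T \<and> x \<in> ball G T n}"

context group begin

lemma inv_mult_cancel:
  assumes "x \<in> carrier G" "y \<in> carrier G"
  shows "inv x \<otimes> (x \<otimes> y) = y" "x \<otimes> (inv x \<otimes> y) = y"
  using assms by (simp_all add: m_assoc[symmetric])

lemma ball_carrier: "T \<subseteq> carrier G \<Longrightarrow> ball G T n \<subseteq> carrier G"
  by (induction n) auto

lemma ball_mono: "m \<le> n \<Longrightarrow> ball G T m \<subseteq> ball G T n"
  by (induction n) (auto simp: le_Suc_eq)

lemma ball_leI: "x \<in> ball G T m \<Longrightarrow> m \<le> n \<Longrightarrow> x \<in> ball G T n"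
  using ball_mono by blast

lemma one_in_ball: "\<one> \<in> ball G T n"
  by (rule ball_leI[of _ T 0]) auto

lemma ball_step: "t \<in> T \<union> m_inv G ` T \<Longrightarrow> x \<in> ball G T n \<Longrightarrow> t \<otimes> x \<in> ball G T (Suc n)"
  unfolding ball.simps by blast

lemma ball_letter: "t \<in> T \<Longrightarrow> t \<in> carrier G \<Longrightarrow> t \<in> ball G T 1"
  using ball_step[of t T \<one> 0] by simp

lemma ball_inv_letter: "t \<in> T \<Longrightarrow> t \<in> carrier G \<Longrightarrow> inv t \<in> ball G T 1"
  using ball_step[of "inv t" T \<one> 0] by simp

lemma ball_mult:
  assumes T: "T \<subseteq> carrier G" and "x \<in> ball G T m" "y \<in> ball G T n"
  shows "x \<otimes> y \<in> ball G T (m + n)"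
  using assms(2)
proof (induction m arbitrary: x)
  case 0
  then show ?case using assms(3) ball_carrier[OF T, of n] by auto
next
  case (Suc m)
  from Suc.prems consider "x \<in> ball G T m"
    | t z where "t \<in> T \<union> m_inv G ` T" "z \<in> ball G T m" "x = t \<otimes> z" by auto
  then show ?case
  proof cases
    case 1
    then show ?thesis using Suc.IH by simp
  next
    case 2
    then have "z \<otimes> y \<in> ball G T (m + n)" using Suc.IH by blast
    moreover have "x \<otimes> y = t \<otimes> (z \<otimes> y)"
      using 2 T assms(3) ball_carrier[OF T] by (auto simp: m_assoc subset_iff)
    ultimately show ?thesis using ball_step[OF 2(1)] by simp
  qed
qed

lemma ball_inv:
  assumes T: "T \<subseteq> carrier G" and "x \<in> ball G T n"
  shows "inv x \<in> ball G T n"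
  using assms(2)
proof (induction n arbitrary: x)
  case (Suc n)
  from Suc.prems consider "x \<in> ball G T n"
    | t z where "t \<in> T \<union> m_inv G ` T" "z \<in> ball G T n" "x = t \<otimes> z" by auto
  then show ?case
  proof cases
    case 1
    then show ?thesis using Suc.IH by simp
  next
    case 2
    then have "inv t \<in> ball G T 1"
      using T ball_letter[of "inv t" T] ball_letter[of _ T] ball_inv_letter[of _ T]
      by (auto simp del: ball.simps One_nat_def simp: subset_iff)
    then have "inv z \<otimes> inv t \<in> ball G T (n + 1)"
      using ball_mult[OF T] Suc.IH 2 by blast
    moreover have "inv x = inv z \<otimes> inv t"
      using 2 T ball_carrier[OF T] by (auto simp: inv_mult_group subset_iff)
    ultimately show ?thesis by simp
  qed
qed simp

lemma ball_nat_pow: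
  assumes "T \<subseteq> carrier G" "x \<in> ball G T n"
  shows "x [^] (k::nat) \<in> ball G T (k * n)"
proof (induction k)
  case 0
  show ?case by simp
next
  case (Suc k)
  have "Suc k * n = k * n + n" by simp
  then show ?case using ball_mult[OF assms(1) Suc assms(2)] by (simp only: nat_pow_Suc)
qed

lemma ball_int_pow:
  assumes "T \<subseteq> carrier G" "x \<in> ball G T n"
  shows "x [^] (j::int) \<in> ball G T (nat \<bar>j\<bar> * n)"
proof (cases "j < 0")
  case True
  then have "x [^] j = inv (x [^] nat \<bar>j\<bar>)"
    by (simp only: int_pow_def2 abs_of_neg if_True)
  then show ?thesis
    using ball_inv[OF assms(1) ball_nat_pow[OF assms]] by metis
next
  case False
  then have "x [^] j = x [^] nat \<bar>j\<bar>" by (simp only: not_less abs_of_nonneg pow_nat)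
  then show ?thesis
    using ball_nat_pow[OF assms] by metis
qed

lemma ball_subst:
  assumes T: "T \<subseteq> carrier G" and U: "U \<subseteq> ball G T c" and x: "x \<in> ball G U n"
  shows "x \<in> ball G T (n * c)"
  using x
proof (induction n arbitrary: x)
  case (Suc n)
  from Suc.prems consider "x \<in> ball G U n"
    | t z where "t \<in> U \<union> m_inv G ` U" "z \<in> ball G U n" "x = t \<otimes> z" by auto
  then show ?case
  proof cases
    case 1
    then show ?thesis using Suc.IH ball_leI by fastforce
  next
    case 2
    then have "t \<in> ball G T c" using U ball_inv[OF T] by auto
    then show ?thesis using ball_mult[OF T _ Suc.IH[OF 2(2)]] 2 by auto
  qed
qed simp

lemma ball_mono_set: "T \<subseteq> U \<Longrightarrow> ball G T n \<subseteq> ball G U n"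
proof (induction n)
  case (Suc n)
  then have "T \<union> m_inv G ` T \<subseteq> U \<union> m_inv G ` U" by blast
  with Suc show ?case unfolding ball.simps by blast
qed simp

lemma ball_subset_generate:
  assumes "T \<subseteq> carrier G"
  shows "ball G T n \<subseteq> generate G T"
proof (induction n)
  case (Suc n)
  have "T \<union> m_inv G ` T \<subseteq> generate G T" by (auto intro: generate.incl generate.inv)
  with Suc show ?case unfolding ball.simps by (blast intro: generate.eng)
qed (auto intro: generate.one)

lemma generate_in_ball:
  assumes T: "T \<subseteq> carrier G" and "x \<in> generate G T"
  shows "\<exists>n. x \<in> ball G T n"
  using assms(2)
proof (induction rule: generate.induct)
  case one
  show ?case using one_in_ball by blast
next
  case (incl h)
  then show ?case using ball_letter T by blast
next
  case (inv h)
  then show ?case using ball_inv_letter T by blast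
next
  case (eng h1 h2)
  then show ?case using ball_mult[OF T] by blast
qed

lemma finite_subset_in_ball:
  assumes T: "T \<subseteq> carrier G" and "finite F" "F \<subseteq> generate G T"
  shows "\<exists>n. F \<subseteq> ball G T n"
  using assms(2,3)
proof (induction F)
  case (insert x F)
  then obtain m where "F \<subseteq> ball G T m" by blast
  moreover obtain n where "x \<in> ball G T n" using generate_in_ball[OF T] insert.prems by blast
  ultimately have "insert x F \<subseteq> ball G T (m + n)"
    using ball_leI[of _ T m "m + n"] ball_leI[of _ T n "m + n"] by auto
  then show ?case by blast
qed simp

lemma word_in_ball:
  "set w \<subseteq> T \<union> m_inv G ` T \<Longrightarrow> foldr (\<lambda>x y. x \<otimes> y) w \<one> \<in> ball G T (length w)"
  by (induction w) auto

lemma ball_has_word: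
  "x \<in> ball G T n \<Longrightarrow>
    \<exists>w. length w \<le> n \<and> set w \<subseteq> T \<union> m_inv G ` T \<and> foldr (\<lambda>x y. x \<otimes> y) w \<one> = x"
proof (induction n arbitrary: x)
  case (Suc n)
  from Suc.prems consider "x \<in> ball G T n"
    | t z where "t \<in> T \<union> m_inv G ` T" "z \<in> ball G T n" "x = t \<otimes> z" by auto
  then show ?case
  proof cases
    case 1
    then show ?thesis using Suc.IH le_SucI by blast
  next
    case 2
    obtain w where "length w \<le> n" "set w \<subseteq> T \<union> m_inv G ` T" "foldr (\<lambda>x y. x \<otimes> y) w \<one> = z"
      using Suc.IH[OF 2(2)] by blast
    then show ?thesis using 2 by (intro exI[of _ "t # w"]) auto
  qed
qed simp

lemma word_length_le_iff:
  assumes T: "T \<subseteq> carrier G" and x: "x \<in> generate G T"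
  shows "word_length G T x \<le> n \<longleftrightarrow> x \<in> ball G T n"
proof
  define P where "P n \<longleftrightarrow> (\<exists>w. length w = n \<and> set w \<subseteq> T \<union> m_inv G ` T \<and>
    foldr (\<lambda>x y. x \<otimes> y) w \<one> = x)" for n
  have wl: "word_length G T x = (LEAST n. P n)" by (simp add: word_length_def P_def)
  have "\<exists>n. P n" using generate_in_ball[OF T x] ball_has_word unfolding P_def by blast
  then have "P (word_length G T x)" unfolding wl by (rule LeastI_ex)
  then have "x \<in> ball G T (word_length G T x)"
    unfolding P_def using word_in_ball[of _ T] by (elim exE conjE) (metis (no_types))
  then show "x \<in> ball G T n" if "word_length G T x \<le> n" using that ball_leI by blast
  show "word_length G T x \<le> n" if x_ball: "x \<in> ball G T n"
  proof -
    obtain w where "length w \<le> n" "set w \<subseteq> T \<union> m_inv G ` T" "foldr (\<lambda>x y. x \<otimes> y) w \<one> = x"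
      using ball_has_word[OF x_ball] by blast
    then show ?thesis unfolding wl using Least_le[of P "length w"] P_def le_trans by blast
  qed
qed

lemma ball_SucE:
  assumes "x \<in> ball G T (Suc n)"
  obtains "x \<in> ball G T n"
  | t z where "t \<in> T \<union> m_inv G ` T" "z \<in> ball G T n" "x = t \<otimes> z"
  using assms by auto

end

declare ball.simps(2) [simp del]

section \<open>Central sequences\<close>

definition commutator :: "('a, 'b) monoid_scheme \<Rightarrow> 'a \<Rightarrow> 'a \<Rightarrow> 'a" where
  "commutator G x y = x \<otimes>\<^bsub>G\<^esub> y \<otimes>\<^bsub>G\<^esub> inv\<^bsub>G\<^esub> x \<otimes>\<^bsub>G\<^esub> inv\<^bsub>G\<^esub> y"

text \<open>
  A polycyclic sequence adapted to a central series: the subgroups generated by the suffixes of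
  the list are normal, and each is central modulo the next one. The successive quotients are cyclic,
  finite or infinite.
\<close>

primrec central_seq :: "('a, 'b) monoid_scheme \<Rightarrow> 'a list \<Rightarrow> bool" where
  "central_seq G [] \<longleftrightarrow> True"
| "central_seq G (a # as) \<longleftrightarrow> a \<in> carrier G \<and> central_seq G as \<and>
     (\<forall>x\<in>carrier G. commutator G a x \<in> generate G (set as))"

context group begin

lemma commutator_closed [simp]:
  "x \<in> carrier G \<Longrightarrow> y \<in> carrier G \<Longrightarrow> commutator G x y \<in> carrier G"
  by (simp add: commutator_def)

lemma conj_eq_commutator:
  assumes "x \<in> carrier G" "y \<in> carrier G"
  shows "x \<otimes> y \<otimes> inv x = commutator G x y \<otimes> y"
    and "x \<otimes> y \<otimes> inv x = inv (commutator G y x) \<otimes> y"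
  using assms by (simp_all add: commutator_def m_assoc inv_mult_group inv_mult_cancel)

lemma subgroup_conj:
  assumes K: "subgroup K G" and g: "g \<in> carrier G"
  shows "subgroup {x \<in> carrier G. g \<otimes> x \<otimes> inv g \<in> K} G"
proof -
  have "g \<otimes> (x \<otimes> y) \<otimes> inv g = (g \<otimes> x \<otimes> inv g) \<otimes> (g \<otimes> y \<otimes> inv g)"
    if "x \<in> carrier G" "y \<in> carrier G" for x y
    using that g by (simp add: m_assoc inv_mult_cancel)
  moreover have "g \<otimes> inv x \<otimes> inv g = inv (g \<otimes> x \<otimes> inv g)" if "x \<in> carrier G" for x
    using that g by (simp add: m_assoc inv_mult_group)
  ultimately show ?thesis
    using g subgroup.m_closed[OF K] subgroup.m_inv_closed[OF K] subgroup.one_closed[OF K]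
    by unfold_locales auto
qed

lemma conj_generate:
  assumes "subgroup K G" "g \<in> carrier G" "T \<subseteq> carrier G"
    and "\<And>t. t \<in> T \<Longrightarrow> g \<otimes> t \<otimes> inv g \<in> K" and "x \<in> generate G T"
  shows "g \<otimes> x \<otimes> inv g \<in> K"
  using generate_subgroup_incl[OF _ subgroup_conj[OF assms(1,2)], of T] assms(3-5) by blast

lemma central_seq_carrier: "central_seq G as \<Longrightarrow> set as \<subseteq> carrier G"
  by (induction as) auto

lemma central_seq_normal: "central_seq G as \<Longrightarrow> generate G (set as) \<lhd> G"
proof (induction as)
  case Nil
  then show ?case by (simp add: generate_empty one_is_normal)
next
  case (Cons a as)
  let ?N = "generate G (set (a # as))"
  have T: "set (a # as) \<subseteq> carrier G" using central_seq_carrier Cons.prems by blast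
  have sub: "subgroup ?N G" using generate_is_subgroup[OF T] .
  have MN: "generate G (set as) \<subseteq> ?N" by (rule mono_generate) auto
  have "g \<otimes> t \<otimes> inv g \<in> ?N" if g: "g \<in> carrier G" and t: "t \<in> set (a # as)" for g t
  proof (cases "t = a")
    case True
    have "g \<otimes> a \<otimes> inv g = inv (commutator G a g) \<otimes> a"
      using g Cons.prems by (intro conj_eq_commutator(2)) auto
    moreover have "commutator G a g \<in> ?N" using MN Cons.prems g by auto
    ultimately show ?thesis
      using True t subgroup.m_closed[OF sub] subgroup.m_inv_closed[OF sub] generate.incl by metis
  next
    case False
    then have "t \<in> generate G (set as)" using t by (auto intro: generate.incl)
    then have "g \<otimes> t \<otimes> inv g \<in> generate G (set as)"
      using Cons normal_invE(2) g by auto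
    then show ?thesis using MN by blast
  qed
  then have "g \<otimes> x \<otimes> inv g \<in> ?N" if "g \<in> carrier G" "x \<in> ?N" for g x
    using conj_generate[OF sub that(1) T _ that(2)] that(1) by blast
  then show ?case using sub normal_inv_iff by blast
qed

lemma subgroup_commutator_in:
  assumes K: "K \<lhd> G" and g: "g \<in> carrier G"
  shows "subgroup {x \<in> carrier G. commutator G x g \<in> K} G"
proof -
  have sub: "subgroup K G" using normal_invE(1)[OF K] .
  have "commutator G (x \<otimes> y) g = (x \<otimes> commutator G y g \<otimes> inv x) \<otimes> commutator G x g"
    if "x \<in> carrier G" "y \<in> carrier G" for x y
    using that g by (simp add: commutator_def m_assoc inv_mult_group inv_mult_cancel)
  moreover have "commutator G (inv x) g \<in> K"
    if x: "x \<in> carrier G" and c: "commutator G x g \<in> K" for x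
  proof -
    have "commutator G (inv x) g = inv x \<otimes> inv (commutator G x g) \<otimes> inv (inv x)"
      using x g by (simp add: commutator_def m_assoc inv_mult_group inv_mult_cancel)
    then show ?thesis
      using normal_invE(2)[OF K inv_closed[OF x] subgroup.m_inv_closed[OF sub c]] by simp
  qed
  moreover have "commutator G \<one> g = \<one>"
    using g by (simp add: commutator_def)
  ultimately show ?thesis
    using subgroup.m_closed[OF sub] subgroup.one_closed[OF sub] normal_invE(2)[OF K]
    by unfold_locales auto
qed

lemma central_seq_commutator:
  assumes cs: "central_seq G (a # as)" and x: "x \<in> generate G (set (a # as))" and g: "g \<in> carrier G"
  shows "commutator G x g \<in> generate G (set as)"
proof -
  let ?M = "generate G (set as)"
  have nM: "?M \<lhd> G" using cs central_seq_normal by simp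
  have sM: "subgroup ?M G" using normal_invE(1)[OF nM] .
  have "commutator G t g \<in> ?M" if t: "t \<in> set as" for t
  proof -
    have t': "t \<in> ?M" "t \<in> carrier G" using t cs central_seq_carrier by (auto intro: generate.incl)
    then have "t \<otimes> (g \<otimes> inv t \<otimes> inv g) \<in> ?M"
      using normal_invE(2)[OF nM g] subgroup.m_closed[OF sM] subgroup.m_inv_closed[OF sM] by blast
    then show ?thesis using t' g by (simp add: commutator_def m_assoc)
  qed
  then have "set (a # as) \<subseteq> {x \<in> carrier G. commutator G x g \<in> ?M}"
    using cs central_seq_carrier g by auto
  then have "generate G (set (a # as)) \<subseteq> {x \<in> carrier G. commutator G x g \<in> ?M}"
    using generate_subgroup_incl subgroup_commutator_in[OF nM g] by blast
  then show ?thesis using x by blast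
qed

section \<open>Collection with polynomial cost\<close>

lemma ball_conj:
  assumes g: "g \<in> carrier G" and T: "T \<subseteq> carrier G" and U: "U \<subseteq> carrier G"
    and conj: "\<And>t. t \<in> T \<Longrightarrow> g \<otimes> t \<otimes> inv g \<in> ball G U c" and x: "x \<in> ball G T n"
  shows "g \<otimes> x \<otimes> inv g \<in> ball G U (n * c)"
  using x
proof (induction n arbitrary: x)
  case 0
  then show ?case using g by simp
next
  case (Suc n)
  from Suc.prems consider "x \<in> ball G T n"
    | t z where "t \<in> T \<union> m_inv G ` T" "z \<in> ball G T n" "x = t \<otimes> z" by (rule ball_SucE)
  then show ?case
  proof cases
    case 1
    then show ?thesis using Suc.IH ball_leI by fastforce
  next
    case 2
    then have tz: "t \<in> carrier G" "z \<in> carrier G" using T ball_carrier[OF T] by auto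
    have "g \<otimes> t \<otimes> inv g \<in> ball G U c"
    proof (cases "t \<in> T")
      case True
      then show ?thesis by (rule conj)
    next
      case False
      then obtain s where s: "s \<in> T" "t = inv s" using 2(1) by blast
      have "g \<otimes> t \<otimes> inv g = inv (g \<otimes> s \<otimes> inv g)"
        using s T g by (auto simp: m_assoc inv_mult_group subset_iff)
      then show ?thesis using ball_inv[OF U conj[OF s(1)]] by simp
    qed
    then have "(g \<otimes> t \<otimes> inv g) \<otimes> (g \<otimes> z \<otimes> inv g) \<in> ball G U (c + n * c)"
      using ball_mult[OF U] Suc.IH[OF 2(2)] by blast
    moreover have "g \<otimes> x \<otimes> inv g = (g \<otimes> t \<otimes> inv g) \<otimes> (g \<otimes> z \<otimes> inv g)"
      using 2(3) tz g by (simp add: m_assoc inv_mult_cancel)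
    ultimately show ?thesis by simp
  qed
qed

text \<open>
  Conjugation by \<open>x\<close> turns \<open>b\<close> into \<open>c b\<close> with \<open>c\<close> further down the series. Hence the \<open>k\<close>-th
  conjugate of \<open>b\<close> is a product of the first \<open>k\<close> conjugates of \<open>c\<close>, followed by \<open>b\<close>. Each step up
  the series sums \<open>k\<close> such lengths, which raises the degree by one.
\<close>

lemma conj_pow_polybounded:
  assumes "central_seq G as" and x: "x \<in> carrier G"
  shows "\<exists>p. polybounded p \<and>
    (\<forall>k::nat. \<forall>b\<in>set as. x [^] k \<otimes> b \<otimes> inv (x [^] k) \<in> ball G (set as) (p k))"
  using assms(1)
proof (induction as)
  case Nil
  then show ?case using polybounded_const by auto
next
  case (Cons b as)
  let ?T = "set as" and ?U = "set (b # as)"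
  have T: "?T \<subseteq> carrier G" and U: "?U \<subseteq> carrier G" and b: "b \<in> carrier G"
    using central_seq_carrier[OF Cons.prems] by auto
  obtain p0 where p0: "polybounded p0"
    "\<And>k t. t \<in> ?T \<Longrightarrow> x [^] (k::nat) \<otimes> t \<otimes> inv (x [^] k) \<in> ball G ?T (p0 k)"
    using Cons by auto
  obtain p where p: "polybounded p" "mono p" "\<And>n. p0 n \<le> p n"
    using polybounded_mono[OF p0(1)] by blast
  define c where "c = inv (commutator G b x)"
  have "commutator G b x \<in> generate G ?T" using Cons.prems x by simp
  then have c: "c \<in> generate G ?T" unfolding c_def using generate_m_inv_closed[OF T] by blast
  obtain L where L: "c \<in> ball G ?T L" using generate_in_ball[OF T c] by blast
  have cC: "c \<in> carrier G" using b x by (simp add: c_def)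
  have conj_b: "x [^] k \<otimes> b \<otimes> inv (x [^] k) \<in> ball G ?U (1 + k * (L * p n))" if "k \<le> n" for k n
    using that
  proof (induction k)
    case 0
    then show ?case using b ball_letter[of b ?U] by simp
  next
    case (Suc k)
    have xk: "x [^] k \<in> carrier G" using x by simp
    have "p0 k \<le> p n" using p(3)[of k] monoD[OF p(2), of k n] Suc.prems by linarith
    then have "x [^] k \<otimes> t \<otimes> inv (x [^] k) \<in> ball G ?T (p n)" if "t \<in> ?T" for t
      using p0(2)[OF that] ball_leI by blast
    then have "x [^] k \<otimes> c \<otimes> inv (x [^] k) \<in> ball G ?T (L * p n)"
      using ball_conj[OF xk T T _ L] by blast
    then have "x [^] k \<otimes> c \<otimes> inv (x [^] k) \<in> ball G ?U (L * p n)"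
      using ball_mono_set[of ?T ?U] by auto
    then have "(x [^] k \<otimes> c \<otimes> inv (x [^] k)) \<otimes> (x [^] k \<otimes> b \<otimes> inv (x [^] k))
        \<in> ball G ?U (L * p n + (1 + k * (L * p n)))"
      using ball_mult[OF U] Suc.IH Suc.prems by (meson Suc_leD)
    moreover have "x [^] Suc k \<otimes> b \<otimes> inv (x [^] Suc k)
        = x [^] k \<otimes> (x \<otimes> b \<otimes> inv x) \<otimes> inv (x [^] k)"
      using x b by (simp add: m_assoc inv_mult_group)
    moreover have "x \<otimes> b \<otimes> inv x = c \<otimes> b"
      unfolding c_def using x b by (rule conj_eq_commutator(2))
    ultimately show ?case
      using xk cC b by (simp add: m_assoc inv_mult_cancel)
  qed
  define q where "q n = p n + (1 + n * (L * p n))" for n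
  have "polybounded q"
    unfolding q_def by (intro polybounded_intros p(1))
  moreover have "x [^] k \<otimes> t \<otimes> inv (x [^] k) \<in> ball G ?U (q k)" if "t \<in> ?U" for k :: nat and t
  proof (cases "t = b")
    case True
    have "1 + k * (L * p k) \<le> q k" by (simp add: q_def)
    then show ?thesis using True conj_b[of k k] ball_leI by blast
  next
    case False
    then have "x [^] k \<otimes> t \<otimes> inv (x [^] k) \<in> ball G ?T (p0 k)" using that p0(2) by simp
    then have "x [^] k \<otimes> t \<otimes> inv (x [^] k) \<in> ball G ?U (p0 k)"
      using ball_mono_set[of ?T ?U] by auto
    moreover have "p0 k \<le> q k" using p(3)[of k] by (simp add: q_def)
    ultimately show ?thesis using ball_leI by blast
  qed
  ultimately show ?case by blast
qed

lemma conj_int_pow_polybounded: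
  assumes cs: "central_seq G as" and x: "x \<in> carrier G"
  obtains p where "polybounded p"
    "\<And>j b n. \<lbrakk>\<bar>j\<bar> \<le> int n; b \<in> set as\<rbrakk> \<Longrightarrow> inv (x [^] j) \<otimes> b \<otimes> x [^] j \<in> ball G (set as) (p n)"
proof -
  obtain p1 where p1: "polybounded p1"
    "\<And>k b. b \<in> set as \<Longrightarrow> x [^] (k::nat) \<otimes> b \<otimes> inv (x [^] k) \<in> ball G (set as) (p1 k)"
    using conj_pow_polybounded[OF cs x] by auto
  obtain p2 where p2: "polybounded p2"
    "\<And>k b. b \<in> set as \<Longrightarrow> inv x [^] (k::nat) \<otimes> b \<otimes> inv (inv x [^] k) \<in> ball G (set as) (p2 k)"
    using conj_pow_polybounded[OF cs inv_closed[OF x]] by auto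
  obtain p where p: "polybounded p" "mono p" "\<And>n. p1 n + p2 n \<le> p n"
    using polybounded_mono[OF polybounded_add[OF p1(1) p2(1)]] by blast
  have "inv (x [^] j) \<otimes> b \<otimes> x [^] j \<in> ball G (set as) (p n)" if j: "\<bar>j\<bar> \<le> int n" and b: "b \<in> set as" for j b n
  proof -
    have le: "p1 (nat \<bar>j\<bar>) + p2 (nat \<bar>j\<bar>) \<le> p n"
      using p(3)[of "nat \<bar>j\<bar>"] monoD[OF p(2), of "nat \<bar>j\<bar>" n] j by linarith
    show ?thesis
    proof (cases "j < 0")
      case True
      then have "x [^] j = inv (x [^] nat \<bar>j\<bar>)" by (simp only: int_pow_def2 abs_of_neg if_True)
      then have "inv (x [^] j) \<otimes> b \<otimes> x [^] j = x [^] nat \<bar>j\<bar> \<otimes> b \<otimes> inv (x [^] nat \<bar>j\<bar>)"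
        using x by simp
      then show ?thesis using p1(2)[OF b, of "nat \<bar>j\<bar>"] le ball_leI by fastforce
    next
      case False
      then have "x [^] j = x [^] nat \<bar>j\<bar>" by (simp only: not_less abs_of_nonneg pow_nat)
      then have "inv (x [^] j) \<otimes> b \<otimes> x [^] j = inv x [^] nat \<bar>j\<bar> \<otimes> b \<otimes> inv (inv x [^] nat \<bar>j\<bar>)"
        by (simp only: nat_pow_inv[OF x] inv_inv[OF nat_pow_closed[OF x]])
      then show ?thesis using p2(2)[OF b, of "nat \<bar>j\<bar>"] le ball_leI by fastforce
    qed
  qed
  then show ?thesis using that p(1) by blast
qed

text \<open>
  The letters \<open>a\<close> and \<open>a\<inverse>\<close> of a word are moved to the left one at a time. Every other letter is
  conjugated by a power of \<open>a\<close> with exponent at most the length of the word.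
\<close>

lemma collect_polybounded:
  assumes cs: "central_seq G (a # as)"
  obtains p where "polybounded p"
    "\<And>n x. x \<in> ball G (set (a # as)) n \<Longrightarrow>
       \<exists>j y. \<bar>j\<bar> \<le> int n \<and> y \<in> ball G (set as) (p n) \<and> x = a [^] (j::int) \<otimes> y"
proof -
  let ?T = "set as" and ?U = "set (a # as)"
  have T: "?T \<subseteq> carrier G" and U: "?U \<subseteq> carrier G" and a: "a \<in> carrier G"
    using central_seq_carrier[OF cs] by auto
  have "central_seq G as" using cs by simp
  then obtain q where q: "polybounded q"
    "\<And>j b n. \<lbrakk>\<bar>j\<bar> \<le> int n; b \<in> ?T\<rbrakk> \<Longrightarrow> inv (a [^] j) \<otimes> b \<otimes> a [^] j \<in> ball G ?T (q n)"
    using conj_int_pow_polybounded a by metis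
  have step: "\<exists>j y. \<bar>j\<bar> \<le> int k \<and> y \<in> ball G ?T (k * q n) \<and> x = a [^] (j::int) \<otimes> y"
    if "k \<le> n" "x \<in> ball G ?U k" for k n x
    using that
  proof (induction k arbitrary: x)
    case 0
    then show ?case by (intro exI[of _ 0] exI[of _ \<one>]) auto
  next
    case (Suc k)
    from Suc.prems(2) consider "x \<in> ball G ?U k"
      | t z where "t \<in> ?U \<union> m_inv G ` ?U" "z \<in> ball G ?U k" "x = t \<otimes> z" by (rule ball_SucE)
    then show ?case
    proof cases
      case 1
      then obtain j y where "\<bar>j\<bar> \<le> int k" "y \<in> ball G ?T (k * q n)" "x = a [^] (j::int) \<otimes> y"
        using Suc by force
      then show ?thesis
        using ball_leI[of y ?T "k * q n" "Suc k * q n"] by (intro exI[of _ j] exI[of _ y]) auto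
    next
      case 2
      then obtain j y where jy: "\<bar>j\<bar> \<le> int k" "y \<in> ball G ?T (k * q n)" "z = a [^] (j::int) \<otimes> y"
        using Suc by force
      have y: "y \<in> carrier G" using jy(2) ball_carrier[OF T] by blast
      consider "t = a [^] (1::int)" | "t = a [^] (- 1::int)" | b where "b \<in> ?T" "t = b \<or> t = inv b"
        using 2(1) a by (auto simp: int_pow_neg)
      then show ?thesis
      proof cases
        case 1
        then have "x = a [^] (1 + j) \<otimes> y"
          using 2(3) jy(3) a y by (simp add: int_pow_mult m_assoc)
        then show ?thesis
          using jy(1,2) ball_leI[of y ?T "k * q n" "Suc k * q n"]
          by (intro exI[of _ "1 + j"] exI[of _ y]) auto
      next
        case inv: 2
        then have "x = a [^] (- 1 + j) \<otimes> y"
          using 2(3) jy(3) a y by (simp only: int_pow_mult m_assoc int_pow_closed)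
        then show ?thesis
          using jy(1,2) ball_leI[of y ?T "k * q n" "Suc k * q n"]
          by (intro exI[of _ "- 1 + j"] exI[of _ y]) auto
      next
        case 3
        let ?d = "inv (a [^] j) \<otimes> t \<otimes> a [^] j"
        have b: "b \<in> carrier G" using 3 T by blast
        have "inv (a [^] j) \<otimes> b \<otimes> a [^] j \<in> ball G ?T (q n)"
          using q(2) 3(1) jy(1) Suc.prems(1) by simp
        moreover have "?d = inv (inv (a [^] j) \<otimes> b \<otimes> a [^] j)" if "t = inv b"
          using that a b by (simp add: inv_mult_group m_assoc)
        ultimately have "?d \<in> ball G ?T (q n)" using 3(2) ball_inv[OF T] by metis
        then have "?d \<otimes> y \<in> ball G ?T (Suc k * q n)"
          using ball_mult[OF T _ jy(2)] by simp
        moreover have "x = a [^] j \<otimes> (?d \<otimes> y)"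
          using 2(3) 3(2) jy(3) a b y by (auto simp: m_assoc inv_mult_cancel)
        ultimately show ?thesis using jy(1) by (intro exI[of _ j] exI[of _ "?d \<otimes> y"]) auto
      qed
    qed
  qed
  have "polybounded (\<lambda>n. n * q n)" by (intro polybounded_intros q(1))
  then show ?thesis using that[of "\<lambda>n. n * q n"] step by blast
qed

end

section \<open>Power subgroups and iterated commutators\<close>

definition power_subgroup :: "('a, 'b) monoid_scheme \<Rightarrow> 'a set \<Rightarrow> nat \<Rightarrow> 'a set" where
  "power_subgroup G K e = generate G ((\<lambda>x. x [^]\<^bsub>G\<^esub> e) ` K)"

lemma (in group_hom) central_seq_image:
  assumes surj: "h ` carrier G = carrier H" and "central_seq G as"
  shows "central_seq H (map h as)"
  using assms(2)
proof (induction as)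
  case Nil
  show ?case by simp
next
  case (Cons a as)
  have gen: "generate H (set (map h as)) = h ` generate G (set as)"
    using generate_img[of "set as"] G.central_seq_carrier[of as] Cons.prems by simp
  have "commutator H (h a) y \<in> generate H (set (map h as))" if "y \<in> carrier H" for y
  proof -
    have "y \<in> h ` carrier G" using that by (simp only: surj)
    then obtain x where x: "x \<in> carrier G" "y = h x" by (rule imageE)
    have a: "a \<in> carrier G" using Cons.prems by simp
    have "commutator H (h a) (h x) = h (commutator G a x)"
      using a x(1) by (simp add: commutator_def)
    then have "commutator H (h a) y = h (commutator G a x)" using x(2) by simp
    moreover have "commutator G a x \<in> generate G (set as)" using Cons.prems x(1) by simp
    ultimately show ?thesis unfolding gen by blast
  qed
  then show ?case using Cons by simp
qed

context normal begin

lemma quotient_hom: "group_hom G (G Mod H) (\<lambda>x. H #> x)"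
  using r_coset_hom_Mod factorgroup_is_group is_group
  by (simp add: group_hom_def group_hom_axioms_def)

lemma quotient_eq_one_iff: "x \<in> carrier G \<Longrightarrow> H #> x = \<one>\<^bsub>G Mod H\<^esub> \<longleftrightarrow> x \<in> H"
  using coset_join1[of H x] coset_join2[of x H] subgroup_axioms by auto

end

context group begin

lemma conj_nat_pow:
  assumes "x \<in> carrier G" "g \<in> carrier G"
  shows "(g \<otimes> x \<otimes> inv g) [^] (k::nat) = g \<otimes> x [^] k \<otimes> inv g"
  using assms by (induction k) (simp_all add: m_assoc inv_mult_cancel)

lemma power_subgroup_normal:
  assumes "K \<lhd> G"
  shows "power_subgroup G K e \<lhd> G"
proof -
  have K: "K \<subseteq> carrier G" using subgroup.subset normal_invE(1)[OF assms] by blast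
  let ?P = "(\<lambda>x. x [^] e) ` K"
  have P: "?P \<subseteq> carrier G" using K by auto
  have sub: "subgroup (generate G ?P) G" using generate_is_subgroup[OF P] .
  have "g \<otimes> t \<otimes> inv g \<in> generate G ?P" if g: "g \<in> carrier G" and t: "t \<in> ?P" for g t
  proof -
    obtain x where x: "x \<in> K" "t = x [^] e" using t by auto
    then have "g \<otimes> t \<otimes> inv g = (g \<otimes> x \<otimes> inv g) [^] e" using g K conj_nat_pow by auto
    then show ?thesis using normal_invE(2)[OF assms g x(1)] by (auto intro: generate.incl)
  qed
  then have "g \<otimes> x \<otimes> inv g \<in> generate G ?P" if "g \<in> carrier G" "x \<in> generate G ?P" for g x
    using conj_generate[OF sub that(1) P _ that(2)] that(1) by blast
  then show ?thesis unfolding power_subgroup_def using sub normal_inv_iff by blast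
qed

text \<open>
  Suppose \<open>w\<close> commutes with all of the tail of the series. For \<open>y\<close> one step higher up,
  \<open>y w y\<inverse> = c w\<close> with \<open>c\<close> in the tail, hence \<open>y w\<^sup>e y\<inverse> = c\<^sup>e w\<^sup>e = w\<^sup>e\<close>. So each step up the series
  costs one more factor \<open>e\<close> in the exponent.
\<close>

lemma pow_commutes_of_exponent:
  assumes "central_seq G bs" and "\<And>y. y \<in> generate G (set bs) \<Longrightarrow> y [^] (e::nat) = \<one>"
    and u: "u \<in> carrier G" and "y \<in> generate G (set bs)"
  shows "u [^] (e ^ length bs) \<otimes> y = y \<otimes> u [^] (e ^ length bs)"
  using assms(1,2,4)
proof (induction bs arbitrary: y)
  case Nil
  then show ?case using u by (simp add: generate_empty)
next
  case (Cons b bs)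
  let ?w = "u [^] (e ^ length bs)" and ?c = "commutator G y (u [^] (e ^ length bs))"
  have w: "?w \<in> carrier G" using u by simp
  have "generate G (set bs) \<subseteq> generate G (set (b # bs))" by (rule mono_generate) auto
  then have sub: "z \<in> generate G (set bs) \<Longrightarrow> z \<in> generate G (set (b # bs))" for z by blast
  have y: "y \<in> carrier G"
    using Cons.prems(3) generate_in_carrier[OF central_seq_carrier[OF Cons.prems(1)]] by blast
  have c: "?c \<in> generate G (set bs)"
    using central_seq_commutator[OF Cons.prems(1,3) w] .
  have cc: "?c \<in> carrier G" using y w by simp
  have comm: "?c \<otimes> ?w = ?w \<otimes> ?c"
    using Cons.IH[of ?c] Cons.prems(1,2) c sub by auto
  have "y \<otimes> ?w [^] e \<otimes> inv y = (y \<otimes> ?w \<otimes> inv y) [^] e"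
    using conj_nat_pow[OF w y] by simp
  also have "\<dots> = (?c \<otimes> ?w) [^] e" using conj_eq_commutator(1)[OF y w] by simp
  also have "\<dots> = ?c [^] e \<otimes> ?w [^] e" using pow_mult_distrib[OF comm cc w] .
  also have "\<dots> = ?w [^] e" using Cons.prems(2)[OF sub[OF c]] w by simp
  finally have conj: "y \<otimes> ?w [^] e \<otimes> inv y = ?w [^] e" .
  have "y \<otimes> ?w [^] e = (y \<otimes> ?w [^] e \<otimes> inv y) \<otimes> y" using y w by (simp add: m_assoc)
  then have "y \<otimes> ?w [^] e = ?w [^] e \<otimes> y" using conj by simp
  moreover have "?w [^] e = u [^] (e ^ length (b # bs))"
    using u by (simp add: nat_pow_pow mult.commute)
  ultimately show ?case by simp
qed

text \<open>
  Since \<open>[u, d]\<close> lies further down the series than \<open>d\<close>, the iterated commutators become trivial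
  after as many steps as the series has. From the bottom upwards, \<open>u d u\<inverse> = [u, d] d\<close> then shows
  that conjugation by \<open>u\<close> and by its inverse preserves the subgroup that they generate.
\<close>

lemma iterated_commutators_invariant:
  assumes "central_seq G as" and "D \<subseteq> generate G (set as)" and u: "u \<in> carrier G"
    and "x \<in> generate G (\<Union>i\<le>length as. (commutator G u ^^ i) ` D)"
  shows "u \<otimes> x \<otimes> inv u \<in> generate G (\<Union>i\<le>length as. (commutator G u ^^ i) ` D) \<and>
    inv u \<otimes> x \<otimes> u \<in> generate G (\<Union>i\<le>length as. (commutator G u ^^ i) ` D)"
  using assms(1,2,4)
proof (induction as arbitrary: D x)
  case Nil
  then have D: "D \<subseteq> {\<one>}" by (simp add: generate_empty)
  have "generate G D \<subseteq> {\<one>}" by (rule generate_subgroup_incl[OF D triv_subgroup])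
  then have "x = \<one>" using Nil by auto
  then show ?case using u by (auto intro: generate.one)
next
  case (Cons b bs)
  let ?f = "commutator G u"
  define R where "R = (\<Union>i\<le>length bs. (?f ^^ i) ` (?f ` D))"
  define Y where "Y = generate G (D \<union> R)"
  have "(\<Union>i\<le>length (b # bs). (?f ^^ i) ` D) = D \<union> (\<Union>i\<le>length bs. (?f ^^ Suc i) ` D)"
    by (simp add: atMost_Suc_eq_insert_0 image_image)
  also have "(\<Union>i\<le>length bs. (?f ^^ Suc i) ` D) = R"
    unfolding R_def funpow_Suc_right by (simp add: image_comp)
  finally have union: "(\<Union>i\<le>length (b # bs). (?f ^^ i) ` D) = D \<union> R" .
  have DC: "D \<subseteq> carrier G"
    using Cons.prems(1,2) generate_in_carrier[OF central_seq_carrier] by blast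
  have "(?f ^^ i) z \<in> carrier G" if "z \<in> carrier G" for i z
    using that u by (induction i) auto
  then have RC: "R \<subseteq> carrier G" using DC u unfolding R_def by auto
  have YC: "D \<union> R \<subseteq> carrier G" using DC RC by blast
  have Y: "subgroup Y G" unfolding Y_def using generate_is_subgroup[OF YC] .
  have RY: "generate G R \<subseteq> Y" unfolding Y_def by (rule mono_generate) auto
  have fD: "?f ` D \<subseteq> generate G (set bs)"
  proof
    fix z assume "z \<in> ?f ` D"
    then obtain d where d: "d \<in> D" "z = ?f d" by auto
    have bsC: "set bs \<subseteq> carrier G" using central_seq_carrier Cons.prems(1) by auto
    have "commutator G d u \<in> generate G (set bs)"
      using central_seq_commutator[OF Cons.prems(1) _ u] d Cons.prems(2) by blast
    moreover have "z = inv (commutator G d u)"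
      using d DC u by (auto simp: commutator_def m_assoc inv_mult_group)
    ultimately show "z \<in> generate G (set bs)" using generate_m_inv_closed[OF bsC] by simp
  qed
  have IH: "u \<otimes> z \<otimes> inv u \<in> generate G R \<and> inv u \<otimes> z \<otimes> u \<in> generate G R"
    if "z \<in> generate G R" for z
    using Cons.IH[OF _ fD, of z] Cons.prems(1) that unfolding R_def by simp
  have letter: "u \<otimes> t \<otimes> inv u \<in> Y \<and> inv u \<otimes> t \<otimes> u \<in> Y" if "t \<in> D \<union> R" for t
  proof (cases "t \<in> R")
    case True
    then show ?thesis using IH[of t] RY by (auto intro: generate.incl)
  next
    case False
    then have t: "t \<in> D" "t \<in> carrier G" "t \<in> Y"
      using that DC unfolding Y_def by (auto intro: generate.incl)
    have "?f t \<in> R" unfolding R_def using t(1) by (auto intro!: bexI[of _ 0])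
    then have c: "?f t \<in> generate G R" by (rule generate.incl)
    have cc: "?f t \<in> carrier G" using t(2) u by simp
    have "u \<otimes> t \<otimes> inv u = ?f t \<otimes> t" using conj_eq_commutator(1)[OF u t(2)] .
    moreover have "inv u \<otimes> t \<otimes> u = inv (inv u \<otimes> ?f t \<otimes> u) \<otimes> t"
      using u t(2) by (simp add: commutator_def m_assoc inv_mult_group inv_mult_cancel)
    ultimately show ?thesis
      using c IH[OF c] RY t(3) subgroup.m_closed[OF Y] subgroup.m_inv_closed[OF Y] by auto
  qed
  have x: "x \<in> generate G (D \<union> R)" using Cons.prems(3) union by simp
  have "u \<otimes> x \<otimes> inv u \<in> Y"
    using conj_generate[OF Y u YC _ x] letter by blast
  moreover have "inv u \<otimes> x \<otimes> inv (inv u) \<in> Y"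
    using conj_generate[OF Y inv_closed[OF u] YC _ x] letter u by simp
  ultimately show ?case using u unfolding union Y_def by simp
qed

lemma conj_int_pow_closed:
  assumes u: "u \<in> carrier G" and Y: "Y \<subseteq> carrier G"
    and inv: "\<And>y. y \<in> Y \<Longrightarrow> u \<otimes> y \<otimes> inv u \<in> Y \<and> inv u \<otimes> y \<otimes> u \<in> Y" and y: "y \<in> Y"
  shows "u [^] (s::int) \<otimes> y \<otimes> inv (u [^] s) \<in> Y"
proof -
  have pow: "g [^] (k::nat) \<otimes> z \<otimes> inv (g [^] k) \<in> Y"
    if g: "g \<in> carrier G" and gY: "\<And>y. y \<in> Y \<Longrightarrow> g \<otimes> y \<otimes> inv g \<in> Y" and z: "z \<in> Y" for g k z
    using z
  proof (induction k arbitrary: z)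
    case 0
    then show ?case using Y by auto
  next
    case (Suc k)
    have "z \<in> carrier G" using Suc.prems Y by blast
    then have "g [^] Suc k \<otimes> z \<otimes> inv (g [^] Suc k) = g [^] k \<otimes> (g \<otimes> z \<otimes> inv g) \<otimes> inv (g [^] k)"
      using g by (simp add: m_assoc inv_mult_group)
    then show ?case using Suc.IH[OF gY[OF Suc.prems]] by simp
  qed
  show ?thesis
  proof (cases s rule: int_cases2)
    case (nonneg n)
    then show ?thesis using pow[OF u _ y, of n] inv by (simp add: int_pow_int)
  next
    case (nonpos n)
    have "u [^] s = inv u [^] n" using nonpos u by (simp only: int_pow_neg_int nat_pow_inv)
    then show ?thesis using pow[OF inv_closed[OF u] _ y, of n] inv u by simp
  qed
qed

end

section \<open>Extending by one cyclic quotient\<close>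

lemma dvd_small_quotient:
  fixes m j :: int
  assumes "m dvd j"
  obtains s where "j = m * s" "\<bar>s\<bar> \<le> \<bar>j\<bar>"
proof (cases "m = 0")
  case True
  then show ?thesis using that[of 0] assms by simp
next
  case False
  obtain s where s: "j = m * s" using assms by blast
  have "1 * \<bar>s\<bar> \<le> \<bar>m\<bar> * \<bar>s\<bar>" using False by (intro mult_right_mono) auto
  then show ?thesis using that[of s] s by (simp add: abs_mult)
qed

locale central_ext = group G for G :: "('a, 'b) monoid_scheme" (structure) +
  fixes a :: 'a and as :: "'a list"
  assumes cs: "central_seq G (a # as)"
begin

abbreviation "T \<equiv> set as"
abbreviation "U \<equiv> set (a # as)"
abbreviation "M \<equiv> generate G T"
abbreviation "N \<equiv> generate G U"

lemma cs_tail: "central_seq G as"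
  using cs by simp

lemma a_closed [simp]: "a \<in> carrier G"
  using cs by simp

lemma T_closed: "T \<subseteq> carrier G" and U_closed: "U \<subseteq> carrier G"
  using central_seq_carrier[OF cs] by auto

lemma M_normal: "M \<lhd> G"
  using central_seq_normal[OF cs_tail] .

lemma M_subgroup: "subgroup M G"
  using normal_invE(1)[OF M_normal] .

sublocale quot: group_hom G "G Mod M" "\<lambda>x. M #> x"
  using normal.quotient_hom[OF M_normal] .

text \<open>
  The exponent of \<open>a\<close> modulo \<open>M\<close>. It is a relation because the exponent is only determined
  modulo \<open>period\<close>, which is \<open>0\<close> if \<open>a\<close> has infinite order modulo \<open>M\<close>.
\<close>

definition val :: "'a \<Rightarrow> int \<Rightarrow> bool" where
  "val x j \<longleftrightarrow> x \<in> carrier G \<and> M #> x = (M #> a) [^]\<^bsub>G Mod M\<^esub> j"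

definition period :: int where
  "period = int (group.ord (G Mod M) (M #> a))"

lemma period_nonneg: "period \<ge> 0"
  by (simp add: period_def)

lemma val_closed: "val x j \<Longrightarrow> x \<in> carrier G"
  by (simp add: val_def)

lemma val_zero_iff: "val x 0 \<longleftrightarrow> x \<in> M"
  using normal.quotient_eq_one_iff[OF M_normal, of x] subgroup.mem_carrier[OF M_subgroup, of x]
  unfolding val_def by auto

lemma val_gen: "val a 1"
  using quot.H.int_pow_1[OF quot.hom_closed[OF a_closed]] by (simp add: val_def)

lemma val_mult: "val x i \<Longrightarrow> val y j \<Longrightarrow> val (x \<otimes> y) (i + j)"
  using quot.H.int_pow_mult[OF quot.hom_closed[OF a_closed], of i j] quot.hom_mult[of x y]
  unfolding val_def by simp

lemma val_int_pow: "val x i \<Longrightarrow> val (x [^] k) (i * k)" for k :: int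
  using quot.H.int_pow_pow[OF quot.hom_closed[OF a_closed], of i k] quot.hom_int_pow[of x k]
  unfolding val_def by simp

lemma val_nat_pow: "val x i \<Longrightarrow> val (x [^] k) (i * int k)" for k :: nat
  using val_int_pow[of x i "int k"] by (simp only: int_pow_int)

lemma val_inv: "val x i \<Longrightarrow> val (inv x) (- i)"
  using val_int_pow[of x i "- 1"] val_closed[of x i] int_pow_neg[of x 1] by simp

lemma val_unique: "val x i \<Longrightarrow> val x j \<Longrightarrow> period dvd i - j"
  using quot.H.int_pow_eq[OF quot.hom_closed[OF a_closed], of j i]
  unfolding val_def period_def by simp

lemma val_transfer: "val x i \<Longrightarrow> period dvd i - j \<Longrightarrow> val x j"
  using quot.H.int_pow_eq[OF quot.hom_closed[OF a_closed], of j i]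
  unfolding val_def period_def by simp

lemma val_in_M_iff: "val x j \<Longrightarrow> x \<in> M \<longleftrightarrow> period dvd j"
  using val_unique[of x j 0] val_transfer[of x j 0] val_zero_iff[of x] by auto

lemma val_one: "val \<one> 0"
  using val_zero_iff subgroup.one_closed[OF M_subgroup] by blast

lemma val_subgroup: "subgroup {x \<in> carrier G. \<exists>j. val x j \<and> m dvd j} G" (is "subgroup ?K G")
proof
  show "?K \<subseteq> carrier G" by blast
  show "\<one> \<in> ?K" using val_one by auto
next
  fix x y assume "x \<in> ?K" "y \<in> ?K"
  then obtain i j where "val x i" "m dvd i" "val y j" "m dvd j" by blast
  then have "val (x \<otimes> y) (i + j)" "m dvd i + j" using val_mult by auto
  then show "x \<otimes> y \<in> ?K" using val_closed by blast
next
  fix x assume "x \<in> ?K"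
  then obtain i where "val x i" "m dvd i" by blast
  then have "val (inv x) (- i)" "m dvd - i" using val_inv by auto
  then show "inv x \<in> ?K" using val_closed by blast
qed

lemma val_exists:
  assumes "x \<in> N"
  shows "\<exists>j. val x j"
proof -
  have "U \<subseteq> {x \<in> carrier G. \<exists>j. val x j \<and> 1 dvd j}"
  proof
    fix t assume t: "t \<in> U"
    show "t \<in> {x \<in> carrier G. \<exists>j. val x j \<and> 1 dvd j}"
    proof (cases "t = a")
      case True
      then show ?thesis using val_gen by auto
    next
      case False
      then have "t \<in> M" using t by (auto intro: generate.incl)
      then show ?thesis using val_zero_iff[of t] val_closed[of t 0] by auto
    qed
  qed
  then have "N \<subseteq> {x \<in> carrier G. \<exists>j. val x j \<and> 1 dvd j}"
    using generate_subgroup_incl val_subgroup by blast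
  then show ?thesis using assms by blast
qed

lemma val_pow_gen: "val (a [^] j) j" for j :: int
  using val_int_pow[OF val_gen, of j] by simp

lemma val_collected: "y \<in> M \<Longrightarrow> val (a [^] (j::int) \<otimes> y) j"
  using val_mult[OF val_pow_gen[of j], of y 0] val_zero_iff by simp

lemma ball_T_subset_M: "ball G T n \<subseteq> M"
  using ball_subset_generate[OF T_closed] .

lemma ball_U_closed: "ball G U n \<subseteq> carrier G"
  using ball_carrier[OF U_closed] .

lemma ball_val:
  assumes "x \<in> ball G U n"
  obtains j where "\<bar>j\<bar> \<le> int n" "val x j"
proof -
  obtain p where p: "polybounded p"
    "\<And>n x. x \<in> ball G U n \<Longrightarrow> \<exists>j y. \<bar>j\<bar> \<le> int n \<and> y \<in> ball G T (p n) \<and> x = a [^] (j::int) \<otimes> y"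
    using collect_polybounded[OF cs] by metis
  obtain j y where "\<bar>j\<bar> \<le> int n" "y \<in> ball G T (p n)" "x = a [^] (j::int) \<otimes> y"
    using p(2)[OF assms] by blast
  then show ?thesis using that val_collected ball_T_subset_M by blast
qed

text \<open>
  For an element of \<open>M\<close>, the exponent in the collected form \<open>a\<^sup>j y\<close> is a multiple of \<open>period\<close>, and
  the power of \<open>a\<close> with exponent \<open>period\<close> is a fixed element of \<open>M\<close>. So \<open>a\<^sup>j\<close> has length linear
  in \<open>j\<close> over the generators of \<open>M\<close>.
\<close>

lemma distortion_polybounded:
  obtains p where "polybounded p" "\<And>n x. x \<in> M \<Longrightarrow> x \<in> ball G U n \<Longrightarrow> x \<in> ball G T (p n)"
proof -
  obtain p where p: "polybounded p"
    "\<And>n x. x \<in> ball G U n \<Longrightarrow> \<exists>j y. \<bar>j\<bar> \<le> int n \<and> y \<in> ball G T (p n) \<and> x = a [^] (j::int) \<otimes> y"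
    using collect_polybounded[OF cs] by metis
  have "a [^] period \<in> M" using val_in_M_iff[OF val_pow_gen] by simp
  then obtain R where R: "a [^] period \<in> ball G T R" using generate_in_ball[OF T_closed] by blast
  have "x \<in> ball G T (n * R + p n)" if x: "x \<in> M" "x \<in> ball G U n" for n x
  proof -
    obtain j y where jy: "\<bar>j\<bar> \<le> int n" "y \<in> ball G T (p n)" "x = a [^] (j::int) \<otimes> y"
      using p(2)[OF x(2)] by blast
    have "val x j" using jy ball_T_subset_M val_collected by blast
    then have "period dvd j" using val_in_M_iff x(1) by blast
    then obtain s where s: "j = period * s" "\<bar>s\<bar> \<le> \<bar>j\<bar>" using dvd_small_quotient by blast
    have "a [^] j = (a [^] period) [^] s" using s(1) by (simp add: int_pow_pow)
    then have "a [^] j \<in> ball G T (nat \<bar>s\<bar> * R)" using ball_int_pow[OF T_closed R] by simp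
    moreover have "nat \<bar>s\<bar> * R \<le> n * R" using s(2) jy(1) by (intro mult_right_mono) auto
    ultimately have "a [^] j \<in> ball G T (n * R)" using ball_leI by blast
    then show ?thesis using ball_mult[OF T_closed _ jy(2)] jy(3) by blast
  qed
  moreover have "polybounded (\<lambda>n. n * R + p n)" by (intro polybounded_intros p(1))
  ultimately show ?thesis using that[of "\<lambda>n. n * R + p n"] by blast
qed

lemma combine_values:
  assumes H: "subgroup H G" and "finite V" and "\<And>v. v \<in> V \<Longrightarrow> \<exists>x\<in>H \<inter> ball G U n. val x v"
  shows "\<exists>u\<in>H \<inter> ball G U ((\<Sum>v\<in>V. nat \<bar>c v\<bar>) * n). val u (\<Sum>v\<in>V. c v * v)"
  using assms(2,3)
proof (induction V)
  case empty
  show ?case using val_one subgroup.one_closed[OF H] by simp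
next
  case (insert v V)
  then obtain u where u: "u \<in> H" "u \<in> ball G U ((\<Sum>v\<in>V. nat \<bar>c v\<bar>) * n)" "val u (\<Sum>v\<in>V. c v * v)"
    by auto
  obtain x where x: "x \<in> H" "x \<in> ball G U n" "val x v" using insert.prems by auto
  have "x [^] c v \<otimes> u \<in> ball G U (nat \<bar>c v\<bar> * n + (\<Sum>v\<in>V. nat \<bar>c v\<bar>) * n)"
    using ball_mult[OF U_closed ball_int_pow[OF U_closed x(2)] u(2)] .
  moreover have "x [^] c v \<otimes> u \<in> H"
    using subgroup.m_closed[OF H] subgroup_int_pow_closed[OF H x(1)] u(1) by blast
  moreover have "val (x [^] c v \<otimes> u) (v * c v + (\<Sum>v\<in>V. c v * v))"
    using val_mult[OF val_int_pow[OF x(3)] u(3)] .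
  moreover have "nat \<bar>c v\<bar> * n + (\<Sum>v\<in>V. nat \<bar>c v\<bar>) * n = (\<Sum>v\<in>insert v V. nat \<bar>c v\<bar>) * n"
    "v * c v + (\<Sum>v\<in>V. c v * v) = (\<Sum>v\<in>insert v V. c v * v)"
    using insert.hyps by (simp_all add: add_mult_distrib)
  ultimately show ?case by (intro bexI[of _ "x [^] c v \<otimes> u"]) (simp_all only: IntI)
qed

text \<open>
  The values of the elements of the subgroup generated by \<open>X\<close> form a group of integers, generated
  by values of size linear in \<open>n\<close>: one for each element of \<open>X\<close>, and \<open>period\<close>, which is a
  value of the identity. Bezout coefficients of polynomial size give a short element whose value
  generates the group.
\<close>

lemma leading_element_polybounded:
  obtains p where "polybounded p"
    "\<And>n X. X \<subseteq> ball G U n \<Longrightarrow> \<exists>m u. 0 \<le> m \<and> m \<le> int (p n) \<and> u \<in> generate G X \<and> u \<in> ball G U (p n)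
       \<and> val u m \<and> (\<forall>h j. h \<in> generate G X \<longrightarrow> val h j \<longrightarrow> m dvd j) \<and> (m = 0 \<longrightarrow> u = \<one>)"
proof -
  define b where "b n = n + nat period + 1" for n
  define p where "p n = (2 * b n + 1) * (4 * b n ^ 3) * n + b n" for n
  have "polybounded p"
    unfolding p_def b_def by (intro polybounded_intros)
  moreover have "\<exists>m u. 0 \<le> m \<and> m \<le> int (p n) \<and> u \<in> generate G X \<and> u \<in> ball G U (p n)
       \<and> val u m \<and> (\<forall>h j. h \<in> generate G X \<longrightarrow> val h j \<longrightarrow> m dvd j) \<and> (m = 0 \<longrightarrow> u = \<one>)"
    if X: "X \<subseteq> ball G U n" for n X
  proof -
    define B where "B = int (b n)"
    define H where "H = generate G X"
    have XC: "X \<subseteq> carrier G" using X ball_U_closed by blast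
    have H: "subgroup H G" unfolding H_def using generate_is_subgroup[OF XC] .
    have B: "B \<ge> 1" "B \<ge> int n" "B \<ge> period" using period_nonneg by (auto simp: B_def b_def)
    define V where "V = {j. \<bar>j\<bar> \<le> B \<and> (\<exists>x\<in>H \<inter> ball G U n. val x j)}"
    have VB: "V \<subseteq> {- B..B}" unfolding V_def by auto
    obtain m c where m: "m \<ge> 0" "m \<le> B" "\<And>v. v \<in> V \<Longrightarrow> m dvd v" "(\<Sum>v\<in>V. c v * v) = m"
      and c: "\<And>v. v \<in> V \<Longrightarrow> \<bar>c v\<bar> \<le> 4 * B ^ 3"
      using bezout_bounded[OF VB B(1)] by blast
    have fin: "finite V" using VB finite_subset by blast
    have "(\<Sum>v\<in>V. nat \<bar>c v\<bar>) \<le> (\<Sum>v\<in>V. 4 * b n ^ 3)"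
    proof (rule sum_mono)
      fix v assume "v \<in> V"
      then have "\<bar>c v\<bar> \<le> int (4 * b n ^ 3)" using c unfolding B_def by simp
      then show "nat \<bar>c v\<bar> \<le> 4 * b n ^ 3" by linarith
    qed
    also have "\<dots> = card V * (4 * b n ^ 3)" by simp
    also have "\<dots> \<le> (2 * b n + 1) * (4 * b n ^ 3)"
    proof (rule mult_le_mono1)
      have "card V \<le> card {- B..B}" using VB by (intro card_mono) auto
      also have "card {- B..B} = 2 * b n + 1" by (simp add: B_def)
      finally show "card V \<le> 2 * b n + 1" .
    qed
    finally have len: "(\<Sum>v\<in>V. nat \<bar>c v\<bar>) * n \<le> p n"
      unfolding p_def by (simp add: mult_le_mono1 trans_le_add1)
    obtain u where u: "u \<in> H" "u \<in> ball G U ((\<Sum>v\<in>V. nat \<bar>c v\<bar>) * n)" "val u m"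
      using combine_values[OF H fin, of n c] m(4) unfolding V_def by auto
    have "m \<le> int (p n)" using m(2) unfolding B_def p_def by linarith
    moreover have "m dvd j" if h: "h \<in> H" "val h j" for h j
    proof -
      have "val \<one> period" using val_one by (rule val_transfer) simp
      then have "period \<in> V"
        unfolding V_def using B period_nonneg subgroup.one_closed[OF H] one_in_ball by auto
      then have "m dvd period" by (rule m(3))
      have "X \<subseteq> {x \<in> carrier G. \<exists>j. val x j \<and> m dvd j}"
      proof
        fix x assume x: "x \<in> X"
        then obtain i where i: "\<bar>i\<bar> \<le> int n" "val x i" using ball_val X by blast
        have "x \<in> H" unfolding H_def using x by (rule generate.incl)
        then have "i \<in> V" unfolding V_def using i B x X by auto
        then show "x \<in> {x \<in> carrier G. \<exists>j. val x j \<and> m dvd j}"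
          using i(2) m(3) val_closed by blast
      qed
      then have "H \<subseteq> {x \<in> carrier G. \<exists>j. val x j \<and> m dvd j}"
        unfolding H_def using generate_subgroup_incl val_subgroup by blast
      then obtain i where i: "val h i" "m dvd i" using h(1) by blast
      have "m dvd i - j" using val_unique[OF i(1) h(2)] \<open>m dvd period\<close> dvd_trans by blast
      then show ?thesis using dvd_diff_right_iff[OF i(2)] by simp
    qed
    ultimately show ?thesis
    proof (cases "m = 0")
      case True
      then have "val \<one> m" using val_one by simp
      then show ?thesis
        using True \<open>m \<le> int (p n)\<close> \<open>\<And>h j. h \<in> H \<Longrightarrow> val h j \<Longrightarrow> m dvd j\<close>
          subgroup.one_closed[OF H] one_in_ball unfolding H_def by blast
    next
      case False
      then show ?thesis
        using u m(1) \<open>m \<le> int (p n)\<close> \<open>\<And>h j. h \<in> H \<Longrightarrow> val h j \<Longrightarrow> m dvd j\<close>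
          ball_leI[OF u(2) len] unfolding H_def by blast
    qed
  qed
  ultimately show ?thesis by (rule that)
qed

end

context central_ext begin

text \<open>
  Let \<open>u\<close> be the leading element of \<open>H\<close>. Then \<open>H\<close> is generated by \<open>u\<close> and short elements of
  \<open>H \<inter> M\<close>. The subgroup \<open>Y\<close> generated by the iterated commutators of the latter with \<open>u\<close>
  is normalised by \<open>u\<close>, so \<open>H\<close> consists of the products of an element of \<open>Y\<close> and a power of \<open>u\<close>.
  Such a product lies in \<open>M\<close> only if the power of \<open>u\<close> does, and the powers of \<open>u\<close> in \<open>M\<close> are those
  of a single short one.
\<close>

lemma intersection_polybounded:
  obtains p where "polybounded p"
    "\<And>n X. X \<subseteq> ball G U n \<Longrightarrow>
       \<exists>X'. X' \<subseteq> ball G T (p n) \<and> generate G X' = generate G X \<inter> M"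
proof -
  obtain pl where pl: "polybounded pl"
    "\<And>n X. X \<subseteq> ball G U n \<Longrightarrow> \<exists>m u. 0 \<le> m \<and> m \<le> int (pl n) \<and> u \<in> generate G X \<and> u \<in> ball G U (pl n)
       \<and> val u m \<and> (\<forall>h j. h \<in> generate G X \<longrightarrow> val h j \<longrightarrow> m dvd j) \<and> (m = 0 \<longrightarrow> u = \<one>)"
    using leading_element_polybounded by metis
  obtain pd where pd: "polybounded pd" "\<And>n x. x \<in> M \<Longrightarrow> x \<in> ball G U n \<Longrightarrow> x \<in> ball G T (pd n)"
    using distortion_polybounded by metis
  define L where "L n = n + n * pl n + (nat period + 1) * pl n" for n
  define p where "p n = pd (4 ^ length as * L n)" for n
  have "polybounded L" unfolding L_def by (intro polybounded_intros pl(1))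
  then have "polybounded p"
    unfolding p_def by (intro polybounded_compose[OF pd(1)] polybounded_intros)
  moreover have "\<exists>X'. X' \<subseteq> ball G T (p n) \<and> generate G X' = generate G X \<inter> M"
    if X: "X \<subseteq> ball G U n" for n X
  proof -
    define H where "H = generate G X"
    have XC: "X \<subseteq> carrier G" using X ball_U_closed by blast
    have H: "subgroup H G" unfolding H_def using generate_is_subgroup[OF XC] .
    obtain m u where m: "0 \<le> m" "m \<le> int (pl n)" "m = 0 \<longrightarrow> u = \<one>"
      and u: "u \<in> H" "u \<in> ball G U (pl n)" "val u m"
      and dvd: "\<And>h j. h \<in> H \<Longrightarrow> val h j \<Longrightarrow> m dvd j"
      using pl(2)[OF X] unfolding H_def by metis
    have uC: "u \<in> carrier G" using val_closed u(3) .
    have u_pow: "u [^] s \<in> H" for s :: int using subgroup_int_pow_closed[OF H u(1)] .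
    define f where "f = commutator G u"
    \<comment> \<open>The radius is large enough for the elements \<open>x u\<^sup>-\<^sup>s\<close> with \<open>x\<close> in \<open>X\<close>, and for a
      power of \<open>u\<close> that generates those lying in \<open>M\<close>.\<close>
    define D where "D = H \<inter> M \<inter> ball G U (L n)"
    define X' where "X' = (\<Union>i\<le>length as. (f ^^ i) ` D)"
    define Y where "Y = generate G X'"
    have f_closed: "f d \<in> H \<inter> M \<inter> ball G U (4 * l)"
      if d: "d \<in> H \<inter> M \<inter> ball G U l" and l: "L n \<le> l" for d l
    proof -
      have dC: "d \<in> carrier G" using d subgroup.mem_carrier[OF H] by blast
      have ul: "u \<in> ball G U l" using ball_leI[OF u(2)] l unfolding L_def by simp
      have "f d \<in> H" unfolding f_def commutator_def
        using d u(1) subgroup.m_closed[OF H] subgroup.m_inv_closed[OF H] by blast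
      moreover have "f d \<in> M" unfolding f_def commutator_def
        using d normal_invE(2)[OF M_normal uC] subgroup.m_closed[OF M_subgroup]
          subgroup.m_inv_closed[OF M_subgroup] by blast
      moreover have "f d \<in> ball G U (l + l + l + l)" unfolding f_def commutator_def
        using d ul ball_mult[OF U_closed] ball_inv[OF U_closed] by blast
      moreover have "l + l + l + l = 4 * l" by simp
      ultimately show ?thesis by (simp only: IntI)
    qed
    have iter: "(f ^^ i) d \<in> H \<inter> M \<inter> ball G U (4 ^ i * L n)" if "d \<in> D" for i d
    proof (induction i)
      case 0
      then show ?case using that by (simp add: D_def)
    next
      case (Suc i)
      have "L n \<le> 4 ^ i * L n" by simp
      from f_closed[OF Suc this] show ?case by (simp add: mult.assoc)
    qed
    have X'_HM: "X' \<subseteq> H \<inter> M" unfolding X'_def using iter by blast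
    have X'_ball: "X' \<subseteq> ball G T (p n)"
    proof
      fix x assume "x \<in> X'"
      then obtain i d where i: "i \<le> length as" "d \<in> D" "x = (f ^^ i) d" unfolding X'_def by blast
      have "(4::nat) ^ i * L n \<le> 4 ^ length as * L n"
        using i(1) by (intro mult_le_mono1 power_increasing) auto
      then have "x \<in> ball G U (4 ^ length as * L n)" using iter[OF i(2), of i] i(3) ball_leI by blast
      then show "x \<in> ball G T (p n)" unfolding p_def using pd(2) iter[OF i(2), of i] i(3) by blast
    qed
    have X'C: "X' \<subseteq> carrier G" using X'_HM subgroup.subset[OF H] by blast
    have Y: "subgroup Y G" unfolding Y_def using generate_is_subgroup[OF X'C] .
    have DY: "D \<subseteq> Y"
    proof
      fix d assume "d \<in> D"
      then have "d \<in> X'" unfolding X'_def by (auto intro!: bexI[of _ 0])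
      then show "d \<in> Y" unfolding Y_def by (rule generate.incl)
    qed
    have Y_HM: "Y \<subseteq> H \<inter> M"
      unfolding Y_def using generate_subgroup_incl[OF X'_HM subgroups_Inter_pair[OF H M_subgroup]] .
    have DM: "D \<subseteq> M" unfolding D_def by blast
    have "u \<otimes> y \<otimes> inv u \<in> Y \<and> inv u \<otimes> y \<otimes> u \<in> Y" if "y \<in> Y" for y
      using iterated_commutators_invariant[OF cs_tail DM uC, of y] that
      unfolding Y_def X'_def f_def by blast
    then have Y_inv: "u [^] s \<otimes> y \<otimes> inv (u [^] s) \<in> Y" if "y \<in> Y" for s :: int and y
      using conj_int_pow_closed[OF uC subgroup.subset[OF Y] _ that] by blast
    define K where "K = {y \<otimes> u [^] s | y s. y \<in> Y \<and> (s::int) \<in> UNIV}"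
    have KI: "y \<otimes> u [^] (s::int) \<in> K" if "y \<in> Y" for y s unfolding K_def using that by blast
    have K: "subgroup K G"
    proof
      show "K \<subseteq> carrier G" unfolding K_def using subgroup.subset[OF Y] uC by auto
      show "\<one> \<in> K" using KI[OF subgroup.one_closed[OF Y], of 0] by simp
    next
      fix x x' assume "x \<in> K" "x' \<in> K"
      then obtain y y' and s s' :: int
        where y: "y \<in> Y" "x = y \<otimes> u [^] s" "y' \<in> Y" "x' = y' \<otimes> u [^] s'" unfolding K_def by blast
      have yC: "y \<in> carrier G" "y' \<in> carrier G" using y subgroup.mem_carrier[OF Y] by auto
      have "x \<otimes> x' = (y \<otimes> (u [^] s \<otimes> y' \<otimes> inv (u [^] s))) \<otimes> u [^] (s + s')"
        unfolding y(2,4) int_pow_mult[OF uC] using yC uC by (simp add: m_assoc inv_mult_cancel)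
      then show "x \<otimes> x' \<in> K" using KI subgroup.m_closed[OF Y y(1) Y_inv[OF y(3)]] by metis
    next
      fix x assume "x \<in> K"
      then obtain y and s :: int where y: "y \<in> Y" "x = y \<otimes> u [^] s" unfolding K_def by blast
      have yC: "y \<in> carrier G" using y subgroup.mem_carrier[OF Y] by auto
      have "inv x = (u [^] (- s) \<otimes> inv y \<otimes> inv (u [^] (- s))) \<otimes> u [^] (- s)"
        unfolding y(2) int_pow_neg[OF uC] using yC uC by (simp add: m_assoc inv_mult_group)
      then show "inv x \<in> K" using KI Y_inv[OF subgroup.m_inv_closed[OF Y y(1)]] by metis
    qed
    have "X \<subseteq> K"
    proof
      fix x assume x: "x \<in> X"
      then have xH: "x \<in> H" unfolding H_def by (rule generate.incl)
      obtain j where j: "\<bar>j\<bar> \<le> int n" "val x j" using ball_val x X by blast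
      have "m dvd j" using dvd[OF xH j(2)] .
      then obtain s where s: "j = m * s" "\<bar>s\<bar> \<le> \<bar>j\<bar>" by (rule dvd_small_quotient)
      have xC: "x \<in> carrier G" using val_closed j(2) .
      let ?y = "x \<otimes> u [^] (- s)"
      have "val ?y (j + m * (- s))" using val_mult[OF j(2) val_int_pow[OF u(3)]] .
      then have "?y \<in> M" using s(1) val_zero_iff by simp
      moreover have "?y \<in> H" using subgroup.m_closed[OF H xH u_pow] .
      moreover have "?y \<in> ball G U (L n)"
      proof -
        have "?y \<in> ball G U (n + nat \<bar>- s\<bar> * pl n)"
          using ball_mult[OF U_closed _ ball_int_pow[OF U_closed u(2)]] x X by blast
        moreover have "nat \<bar>- s\<bar> * pl n \<le> n * pl n" using s(2) j(1) by (intro mult_le_mono1) linarith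
        ultimately show ?thesis using ball_leI unfolding L_def by (meson add_le_mono1 nat_add_left_cancel_le trans_le_add1)
      qed
      ultimately have "?y \<in> Y" using DY unfolding D_def by blast
      then have "?y \<otimes> u [^] s \<in> K" by (rule KI)
      moreover have "?y \<otimes> u [^] s = x"
        unfolding int_pow_neg[OF uC] using xC uC by (simp add: m_assoc)
      ultimately show "x \<in> K" by simp
    qed
    then have HK: "H \<subseteq> K" unfolding H_def using generate_subgroup_incl K by blast
    have u_pow_Y: "u [^] s \<in> Y" if s: "u [^] (s::int) \<in> M" for s
    proof (cases "m = 0")
      case True
      then have "u = \<one>" using m(3) by blast
      then show ?thesis using subgroup.one_closed[OF Y] by simp
    next
      case False
      have "val \<one> period" using val_one by (rule val_transfer) simp
      then have "m dvd period" using dvd subgroup.one_closed[OF H] by blast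
      then obtain r where r: "period = m * r" "\<bar>r\<bar> \<le> \<bar>period\<bar>" by (rule dvd_small_quotient)
      have "val (u [^] r) (m * r)" using val_int_pow[OF u(3)] .
      then have "u [^] r \<in> M" using val_in_M_iff r(1) by simp
      moreover have "u [^] r \<in> ball G U (L n)"
      proof -
        have "u [^] r \<in> ball G U (nat \<bar>r\<bar> * pl n)" using ball_int_pow[OF U_closed u(2)] .
        moreover have "nat \<bar>r\<bar> * pl n \<le> (nat period + 1) * pl n"
          using r(2) period_nonneg by (intro mult_le_mono1) linarith
        ultimately show ?thesis using ball_leI unfolding L_def by (meson trans_le_add2)
      qed
      ultimately have r_Y: "u [^] r \<in> Y" using DY u_pow unfolding D_def by blast
      have "val (u [^] s) (m * s)" using val_int_pow[OF u(3)] .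
      then have "m * r dvd m * s" using val_in_M_iff s r(1) by metis
      then have "r dvd s" using False by simp
      then obtain q where q: "s = r * q" by blast
      then have "u [^] s = (u [^] r) [^] q" using int_pow_pow[OF uC] by simp
      then show ?thesis using subgroup_int_pow_closed[OF Y r_Y] by simp
    qed
    have "H \<inter> M \<subseteq> Y"
    proof
      fix h assume h: "h \<in> H \<inter> M"
      then obtain y and s :: int where y: "y \<in> Y" "h = y \<otimes> u [^] s" using HK unfolding K_def by blast
      have yC: "y \<in> carrier G" using y subgroup.mem_carrier[OF Y] by auto
      have "u [^] s = inv y \<otimes> h" unfolding y(2) using yC uC by (simp add: inv_mult_cancel)
      moreover have "inv y \<otimes> h \<in> M"
        using y(1) Y_HM h subgroup.m_closed[OF M_subgroup] subgroup.m_inv_closed[OF M_subgroup] by blast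
      ultimately have "u [^] s \<in> M" by (simp only:)
      then have "u [^] s \<in> Y" by (rule u_pow_Y)
      then show "h \<in> Y" unfolding y(2) using subgroup.m_closed[OF Y y(1)] by blast
    qed
    then have "Y = H \<inter> M" using Y_HM by blast
    then show ?thesis using X'_ball unfolding Y_def H_def by blast
  qed
  ultimately show ?thesis by (rule that)
qed

text \<open>
  Modulo the \<open>e\<close>-th powers of \<open>M\<close>, the element \<open>u\<^sup>t\<close> with \<open>t = e\<^sup>l\<close>, where \<open>l\<close> is the length of \<open>as\<close>,
  commutes with \<open>M\<close>. For \<open>x\<close> of value \<open>j\<close>, the elements \<open>x\<^sup>m\<close> and \<open>u\<^sup>j\<close> have the same value, so
  \<open>x\<^sup>m\<^sup>t = y u\<^sup>j\<^sup>t\<close> with \<open>y\<close> in \<open>M\<close>, and raising this to the \<open>e\<close>-th power leaves a power of \<open>u\<^sup>t\<close>.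
\<close>

lemma power_subgroup_extension:
  assumes u: "val u (int m)"
    and w: "w \<in> power_subgroup G N (m * e ^ Suc (length as))"
  obtains k :: int and v where "v \<in> power_subgroup G M e" "w = v \<otimes> u [^] (int (e ^ length as) * k)"
proof -
  define V where "V = power_subgroup G M e"
  define t where "t = e ^ length as"
  have nV: "V \<lhd> G" unfolding V_def using power_subgroup_normal[OF M_normal] .
  let ?Q = "G Mod V"
  define q where "q x = V #> x" for x
  interpret q: group_hom G ?Q q unfolding q_def using normal.quotient_hom[OF nV] .
  have q_one: "x \<in> carrier G \<Longrightarrow> q x = \<one>\<^bsub>?Q\<^esub> \<longleftrightarrow> x \<in> V" for x
    unfolding q_def using normal.quotient_eq_one_iff[OF nV] .
  have uC: "u \<in> carrier G" using val_closed u .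
  have surj: "q ` carrier G = carrier ?Q" by (simp add: carrier_FactGroup q_def)
  have csQ: "central_seq ?Q (map q as)" using q.central_seq_image[OF surj cs_tail] .
  have gen: "generate ?Q (set (map q as)) = q ` M" using q.generate_img[OF T_closed] by simp
  have exponent: "z [^]\<^bsub>?Q\<^esub> e = \<one>\<^bsub>?Q\<^esub>" if "z \<in> generate ?Q (set (map q as))" for z
  proof -
    obtain y where y: "y \<in> M" "z = q y" using \<open>z \<in> _\<close> gen by blast
    have yC: "y \<in> carrier G" using subgroup.mem_carrier[OF M_subgroup y(1)] .
    have "y [^] e \<in> V" unfolding V_def power_subgroup_def using y(1) by (auto intro: generate.incl)
    then have "q (y [^] e) = \<one>\<^bsub>?Q\<^esub>" using q_one yC by simp
    then show ?thesis using q.hom_nat_pow[OF yC] y(2) by simp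
  qed
  define K where "K = {x \<in> carrier G. \<exists>k::int. q x = q (u [^] (int t * k))}"
  have K: "subgroup K G"
  proof
    show "K \<subseteq> carrier G" unfolding K_def by blast
    have "q \<one> = q (u [^] (int t * 0))" by simp
    then show "\<one> \<in> K" unfolding K_def by blast
  next
    fix x y assume "x \<in> K" "y \<in> K"
    then obtain k l :: int where kl: "x \<in> carrier G" "y \<in> carrier G"
      "q x = q (u [^] (int t * k))" "q y = q (u [^] (int t * l))" unfolding K_def by blast
    have "q (x \<otimes> y) = q (u [^] (int t * k) \<otimes> u [^] (int t * l))" using kl uC by simp
    also have "\<dots> = q (u [^] (int t * (k + l)))" by (simp only: int_pow_mult[OF uC] distrib_left)
    finally show "x \<otimes> y \<in> K" unfolding K_def using kl by blast
  next
    fix x assume "x \<in> K"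
    then obtain k :: int where k: "x \<in> carrier G" "q x = q (u [^] (int t * k))" unfolding K_def by blast
    have "q (inv x) = q (inv (u [^] (int t * k)))" using k uC by simp
    also have "\<dots> = q (u [^] (int t * - k))" by (simp only: int_pow_neg[OF uC] mult_minus_right)
    finally show "inv x \<in> K" unfolding K_def using k by blast
  qed
  have "x [^] (m * e ^ Suc (length as)) \<in> K" if x: "x \<in> N" for x
  proof -
    obtain j where j: "val x j" using val_exists[OF x] by blast
    have xC: "x \<in> carrier G" using val_closed j .
    let ?w = "u [^] j" and ?y = "x [^] (m * t) \<otimes> inv ((u [^] j) [^] t)"
    have wC: "?w \<in> carrier G" using uC by simp
    have "val ?y (j * int (m * t) + - (int m * j * int t))"
      by (intro val_mult val_inv val_nat_pow val_int_pow j u)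
    then have "?y \<in> M" using val_zero_iff by (simp add: mult_ac)
    then have yQ: "q ?y \<in> generate ?Q (set (map q as))" using gen by blast
    have yC: "?y \<in> carrier G" using xC wC by simp
    have comm: "q ?y \<otimes>\<^bsub>?Q\<^esub> q (?w [^] t) = q (?w [^] t) \<otimes>\<^bsub>?Q\<^esub> q ?y"
      using q.H.pow_commutes_of_exponent[OF csQ exponent q.hom_closed[OF wC] yQ] q.hom_nat_pow[OF wC]
      unfolding t_def by simp
    have "x [^] (m * t) = ?y \<otimes> ?w [^] t" using xC wC by (simp add: m_assoc)
    then have "q (x [^] (m * t)) = q ?y \<otimes>\<^bsub>?Q\<^esub> q (?w [^] t)"
      by (rule trans[OF arg_cong[of _ _ q] q.hom_mult[OF yC nat_pow_closed[OF wC]]])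
    then have "q (x [^] (m * t)) [^]\<^bsub>?Q\<^esub> e = q ?y [^]\<^bsub>?Q\<^esub> e \<otimes>\<^bsub>?Q\<^esub> q (?w [^] t) [^]\<^bsub>?Q\<^esub> e"
      using q.H.pow_mult_distrib[OF comm q.hom_closed[OF yC] q.hom_closed[OF nat_pow_closed[OF wC]]] by simp
    also have "\<dots> = q ((?w [^] t) [^] e)"
      by (simp only: exponent[OF yQ] q.hom_nat_pow[OF nat_pow_closed[OF wC]] q.H.l_one
          q.H.nat_pow_closed q.hom_closed[OF nat_pow_closed[OF wC]])
    also have "(?w [^] t) [^] e = u [^] (int t * (j * int e))"
    proof -
      have "(?w [^] t) [^] e = ?w [^] (int (t * e))" using nat_pow_pow[OF wC] by (simp only: int_pow_int)
      also have "\<dots> = u [^] (j * int (t * e))" by (rule int_pow_pow[OF uC])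
      finally show ?thesis by (simp add: mult_ac)
    qed
    finally have "q (x [^] (m * t)) [^]\<^bsub>?Q\<^esub> e = q (u [^] (int t * (j * int e)))" .
    moreover have "q (x [^] (m * t)) [^]\<^bsub>?Q\<^esub> e = q (x [^] (m * e ^ Suc (length as)))"
      using q.hom_nat_pow[OF nat_pow_closed[OF xC], of "m * t" e] nat_pow_pow[OF xC, of "m * t" e]
      by (simp add: t_def mult_ac)
    ultimately have "q (x [^] (m * e ^ Suc (length as))) = q (u [^] (int t * (j * int e)))" by (simp only:)
    then show ?thesis unfolding K_def using nat_pow_closed[OF xC] by blast
  qed
  then have "(\<lambda>x. x [^] (m * e ^ Suc (length as))) ` N \<subseteq> K" by blast
  then have "w \<in> K"
    using w generate_subgroup_incl[OF _ K] unfolding power_subgroup_def by blast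
  then obtain k :: int where k: "w \<in> carrier G" "q w = q (u [^] (int t * k))" unfolding K_def by blast
  let ?v = "w \<otimes> inv (u [^] (int t * k))"
  have uk: "u [^] (int t * k) \<in> carrier G" using uC by simp
  then have "q ?v = \<one>\<^bsub>?Q\<^esub>"
    by (simp only: q.hom_mult q.hom_inv inv_closed k q.H.r_inv q.hom_closed)
  then have "?v \<in> V" using q_one[of ?v] m_closed[OF k(1) inv_closed[OF uk]] by blast
  moreover have "w = ?v \<otimes> u [^] (int t * k)" using k(1) uC by (simp add: m_assoc)
  ultimately show ?thesis using that unfolding V_def t_def by blast
qed

lemma power_subgroup_val:
  assumes "w \<in> power_subgroup G N e"
  obtains j where "val w j" "int e dvd j"
proof -
  have "x [^] e \<in> {x \<in> carrier G. \<exists>j. val x j \<and> int e dvd j}" if x: "x \<in> N" for x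
  proof -
    obtain j where j: "val x j" using val_exists[OF x] by blast
    then show ?thesis using val_nat_pow[OF j, of e] val_closed by auto
  qed
  then have "power_subgroup G N e \<subseteq> {x \<in> carrier G. \<exists>j. val x j \<and> int e dvd j}"
    unfolding power_subgroup_def by (intro generate_subgroup_incl val_subgroup) blast
  then show ?thesis using assms that by blast
qed

end

section \<open>Separation by power subgroups\<close>

definition separated :: "('a, 'b) monoid_scheme \<Rightarrow> 'a set \<Rightarrow> 'a set \<Rightarrow> 'a \<Rightarrow> bool" where
  "separated G V H g \<longleftrightarrow> (\<forall>v\<in>V. \<forall>h\<in>H. g \<noteq> v \<otimes>\<^bsub>G\<^esub> h)"

text \<open>
  If the value of \<open>g\<close> is not among the values of \<open>H\<close>, the cyclic quotient already separates. Otherwise,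
  division by a power of the leading element moves \<open>g\<close> into \<open>M\<close>, where the induction
  hypothesis applies to \<open>H \<inter> M\<close>.
\<close>

lemma (in central_ext) separation_step:
  assumes p0: "polybounded p0"
    "\<And>n X g. \<lbrakk>X \<subseteq> ball G T n; g \<in> ball G T n; g \<notin> generate G X\<rbrakk> \<Longrightarrow>
       \<exists>e>0. e \<le> p0 n \<and> separated G (power_subgroup G M e) (generate G X) g"
  shows "\<exists>p. polybounded p \<and> (\<forall>n X g. X \<subseteq> ball G U n \<longrightarrow> g \<in> ball G U n \<longrightarrow> g \<notin> generate G X \<longrightarrow>
       (\<exists>e>0. e \<le> p n \<and> separated G (power_subgroup G N e) (generate G X) g))"
proof -
  obtain pl where pl: "polybounded pl"
    "\<And>n X. X \<subseteq> ball G U n \<Longrightarrow> \<exists>m u. 0 \<le> m \<and> m \<le> int (pl n) \<and> u \<in> generate G X \<and> u \<in> ball G U (pl n)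
       \<and> val u m \<and> (\<forall>h j. h \<in> generate G X \<longrightarrow> val h j \<longrightarrow> m dvd j) \<and> (m = 0 \<longrightarrow> u = \<one>)"
    using leading_element_polybounded by metis
  obtain pd where pd: "polybounded pd" "\<And>n x. x \<in> M \<Longrightarrow> x \<in> ball G U n \<Longrightarrow> x \<in> ball G T (pd n)"
    using distortion_polybounded by metis
  obtain pi where pi: "polybounded pi" "\<And>n X. X \<subseteq> ball G U n \<Longrightarrow>
       \<exists>X'. X' \<subseteq> ball G T (pi n) \<and> generate G X' = generate G X \<inter> M"
    using intersection_polybounded by metis
  define n1 where "n1 n = pd (n * pl n + n) + pi n" for n
  define p where "p n = (pl n + n + 1) * (p0 (n1 n) + 1) ^ Suc (length as)" for n
  have "polybounded n1"
    unfolding n1_def by (intro polybounded_compose[OF pd(1)] polybounded_intros pl(1) pi(1))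
  then have poly: "polybounded p"
    unfolding p_def by (intro polybounded_compose[OF p0(1)] polybounded_intros pl(1))
  have big: "k \<le> p n" if "k \<le> pl n + n + 1" for k n
  proof -
    have "(pl n + n + 1) * 1 \<le> p n" unfolding p_def by (intro mult_le_mono2 one_le_power) simp
    then show ?thesis using that by simp
  qed
  have "\<exists>e>0. e \<le> p n \<and> separated G (power_subgroup G N e) (generate G X) g"
    if X: "X \<subseteq> ball G U n" and g: "g \<in> ball G U n" and gX: "g \<notin> generate G X" for n X g
  proof -
    define H where "H = generate G X"
    have XC: "X \<subseteq> carrier G" using X ball_U_closed by blast
    have H: "subgroup H G" unfolding H_def using generate_is_subgroup[OF XC] .
    have HN: "H \<subseteq> N"
      unfolding H_def using generate_subgroup_incl[OF _ generate_is_subgroup[OF U_closed]]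
        X ball_subset_generate[OF U_closed] by blast
    have gC: "g \<in> carrier G" using g ball_U_closed by blast
    obtain m u where m: "0 \<le> m" "m \<le> int (pl n)" "m = 0 \<longrightarrow> u = \<one>"
      and u: "u \<in> H" "u \<in> ball G U (pl n)" "val u m"
      and dvd: "\<And>h j. h \<in> H \<Longrightarrow> val h j \<Longrightarrow> m dvd j"
      using pl(2)[OF X] unfolding H_def by metis
    have uC: "u \<in> carrier G" using val_closed u(3) .
    obtain j where j: "\<bar>j\<bar> \<le> int n" "val g j" using ball_val g by blast
    show ?thesis
    proof (cases "m dvd j")
      case False
      define e where "e = (if m = 0 then nat \<bar>j\<bar> + 1 else nat m)"
      have "e > 0" unfolding e_def using m(1) by simp
      moreover have "e \<le> p n" using m j(1) by (intro big) (simp add: e_def, linarith)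
      moreover have "separated G (power_subgroup G N e) H g"
        unfolding separated_def
      proof (intro ballI notI)
        fix v h assume v: "v \<in> power_subgroup G N e" and h: "h \<in> H" and eq: "g = v \<otimes> h"
        obtain i where i: "val v i" "int e dvd i" using power_subgroup_val[OF v] by blast
        obtain l where l: "val h l" using val_exists HN h by blast
        have "m dvd l" using dvd[OF h l] .
        have "val \<one> period" using val_one by (rule val_transfer) simp
        then have "m dvd period" using dvd subgroup.one_closed[OF H] by blast
        moreover have "period dvd j - (i + l)" using val_unique[OF j(2)] val_mult[OF i(1) l] eq by simp
        ultimately have mj: "m dvd j - (i + l)" by (rule dvd_trans)
        show False
        proof (cases "m = 0")
          case True
          then have "j = i" using mj \<open>m dvd l\<close> by simp
          then have "int e dvd \<bar>j\<bar>" "\<bar>j\<bar> > 0" using i(2) \<open>\<not> m dvd j\<close> True by auto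
          then have "int e \<le> \<bar>j\<bar>" by (rule zdvd_imp_le)
          then show False using True by (simp add: e_def)
        next
          case nz: False
          then have "m dvd i" using i(2) m(1) by (simp add: e_def)
          then have "m dvd j - (i + l) + (i + l)" using mj \<open>m dvd l\<close> by (intro dvd_add)
          then show False using \<open>\<not> m dvd j\<close> by simp
        qed
      qed
      ultimately show ?thesis unfolding H_def by blast
    next
      case True
      then obtain s where s: "j = m * s" "\<bar>s\<bar> \<le> \<bar>j\<bar>" by (rule dvd_small_quotient)
      define g' where "g' = g \<otimes> u [^] (- s)"
      have us: "u [^] (- s) \<in> H" using subgroup_int_pow_closed[OF H u(1)] .
      have "val g' (j + m * (- s))" unfolding g'_def using val_mult[OF j(2) val_int_pow[OF u(3)]] .
      then have g'M: "g' \<in> M" using s(1) val_zero_iff by simp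
      have "nat \<bar>- s\<bar> * pl n \<le> n * pl n" using s(2) j(1) by (intro mult_le_mono1) linarith
      then have le: "n + nat \<bar>- s\<bar> * pl n \<le> n * pl n + n" by simp
      have "g' \<in> ball G U (n * pl n + n)"
        unfolding g'_def
        using ball_leI[OF ball_mult[OF U_closed g ball_int_pow[OF U_closed u(2), of "- s"]] le] .
      then have "g' \<in> ball G T (pd (n * pl n + n))" using pd(2) g'M by blast
      then have g'_ball: "g' \<in> ball G T (n1 n)" using ball_leI unfolding n1_def by (meson le_add1)
      obtain X' where X': "X' \<subseteq> ball G T (pi n)" "generate G X' = H \<inter> M"
        using pi(2)[OF X] unfolding H_def by blast
      have X'_ball: "X' \<subseteq> ball G T (n1 n)"
        using X'(1) ball_mono[of "pi n" "n1 n" T] unfolding n1_def by auto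
      have g_eq: "g = g' \<otimes> u [^] s"
        unfolding g'_def int_pow_neg[OF uC] using uC gC by (simp add: m_assoc)
      have "g' \<notin> H \<inter> M"
      proof
        assume "g' \<in> H \<inter> M"
        then have "g \<in> H"
          unfolding g_eq using subgroup.m_closed[OF H _ subgroup_int_pow_closed[OF H u(1)]] by blast
        then show False using gX unfolding H_def by blast
      qed
      then obtain e0 where e0: "e0 > 0" "e0 \<le> p0 (n1 n)" "separated G (power_subgroup G M e0) (H \<inter> M) g'"
        using p0(2)[OF X'_ball g'_ball] X'(2) by auto
      define t where "t = e0 ^ length as"
      \<comment> \<open>If all values of \<open>H\<close> vanish, \<open>a\<close> takes the place of the leading element.\<close>
      define m' where "m' = (if m = 0 then 1 else nat m)"
      define u' where "u' = (if m = 0 then a else u)"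
      have u': "val u' (int m')" using u(3) m(1) val_gen unfolding u'_def m'_def by simp
      have u'C: "u' \<in> carrier G" using val_closed u' .
      define e where "e = m' * e0 ^ Suc (length as)"
      have "e > 0" unfolding e_def m'_def using e0(1) m(1) by simp
      moreover have "e \<le> p n"
        unfolding e_def p_def
      proof (rule mult_le_mono)
        show "m' \<le> pl n + n + 1" using m(2) unfolding m'_def by (simp, linarith)
        show "e0 ^ Suc (length as) \<le> (p0 (n1 n) + 1) ^ Suc (length as)"
          using e0(2) by (intro power_mono) auto
      qed
      moreover have "separated G (power_subgroup G N e) H g"
        unfolding separated_def
      proof (intro ballI notI)
        fix w h assume w: "w \<in> power_subgroup G N e" and h: "h \<in> H" and eq: "g = w \<otimes> h"
        obtain k :: int and v where v: "v \<in> power_subgroup G M e0"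
          and w_eq: "w = v \<otimes> u' [^] (int t * k)"
          using power_subgroup_extension[OF u', of w e0] w unfolding e_def t_def by blast
        have M_nat_pow: "x [^] e0 \<in> M" if "x \<in> M" for x
          using subgroup_int_pow_closed[OF M_subgroup that, of "int e0"] by (simp only: int_pow_int)
        then have "(\<lambda>x. x [^] e0) ` M \<subseteq> M" by blast
        then have powM: "power_subgroup G M e0 \<subseteq> M"
          unfolding power_subgroup_def by (rule generate_subgroup_incl[OF _ M_subgroup])
        have vM: "v \<in> M" using v powM by blast
        have vC: "v \<in> carrier G" using subgroup.mem_carrier[OF M_subgroup vM] .
        have hC: "h \<in> carrier G" using subgroup.mem_carrier[OF H h] .
        have wC: "u' [^] (int t * k) \<in> carrier G" using u'C by simp
        define h' where "h' = h \<otimes> u [^] (- s)"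
        define x where "x = u' [^] (int t * k) \<otimes> h'"
        have h': "h' \<in> H" unfolding h'_def using subgroup.m_closed[OF H h us] .
        have h'C: "h' \<in> carrier G" using subgroup.mem_carrier[OF H h'] .
        have xC: "x \<in> carrier G" unfolding x_def using wC h'C by simp
        have "g' = v \<otimes> x"
          unfolding g'_def eq w_eq x_def h'_def using vC wC hC uC by (simp add: m_assoc)
        moreover from this have "x = inv v \<otimes> g'" using vC xC by (simp add: inv_mult_cancel)
        then have xM: "x \<in> M"
          using g'M subgroup.m_closed[OF M_subgroup] subgroup.m_inv_closed[OF M_subgroup vM] by blast
        moreover have "x \<in> H"
        proof (cases "m = 0")
          case True
          obtain l where l: "val h' l" using val_exists HN h' by blast
          then have "l = 0" using dvd[OF h' l] True by simp
          have "val \<one> period" using val_one by (rule val_transfer) simp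
          then have "period = 0" using dvd[OF subgroup.one_closed[OF H]] True by simp
          have "val x (int m' * (int t * k) + l)"
            unfolding x_def using val_mult[OF val_int_pow[OF u'] l] .
          then have "int t * k = 0"
            using val_in_M_iff xM \<open>l = 0\<close> \<open>period = 0\<close> True by (auto simp: m'_def)
          then have "x = h'" unfolding x_def using h'C by (simp only: int_pow_0 l_one)
          then show ?thesis using h' by simp
        next
          case False
          then show ?thesis
            unfolding x_def u'_def
            using subgroup.m_closed[OF H subgroup_int_pow_closed[OF H u(1)] h'] by simp
        qed
        ultimately show False using e0(3) v unfolding separated_def by blast
      qed
      ultimately show ?thesis unfolding H_def by blast
    qed
  qed
  then show ?thesis using poly by blast
qed

text \<open>
  The statement behind the upper bound. The list is extended at its head, so the induction climbs
  the central series from the bottom.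
\<close>

lemma (in group) separation_polybounded:
  assumes "central_seq G as"
  shows "\<exists>p. polybounded p \<and> (\<forall>n X g. X \<subseteq> ball G (set as) n \<longrightarrow> g \<in> ball G (set as) n \<longrightarrow>
      g \<notin> generate G X \<longrightarrow>
      (\<exists>e>0. e \<le> p n \<and> separated G (power_subgroup G (generate G (set as)) e) (generate G X) g))"
  using assms
proof (induction as)
  case Nil
  have "ball G {} n \<subseteq> {\<one>}" for n
    by (induction n) (auto elim: ball_SucE)
  then have "g \<in> ball G {} n \<Longrightarrow> g \<in> generate G X" for g n X
    using generate.one[of G X] by blast
  then show ?case using polybounded_const[of 0] by (intro exI[of _ "\<lambda>_. 0"]) auto
next
  case (Cons a as)
  interpret central_ext G a as using Cons.prems by unfold_locales
  show ?case using Cons.IH[OF cs_tail] separation_step by metis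
qed

section \<open>The index of a power subgroup\<close>

text \<open>In the collected form \<open>a\<^sup>j y\<close>, the exponent \<open>j\<close> only matters modulo \<open>e\<close>.\<close>

lemma (in group) power_subgroup_transversal:
  assumes "central_seq G as" and "e > 0"
  shows "\<exists>F. finite F \<and> card F \<le> e ^ length as \<and> F \<subseteq> carrier G \<and>
    (\<forall>x\<in>generate G (set as). \<exists>f\<in>F. \<exists>v\<in>power_subgroup G (carrier G) e. x = v \<otimes> f)"
  using assms(1)
proof (induction as)
  case Nil
  have "\<one> \<in> power_subgroup G (carrier G) e" unfolding power_subgroup_def by (rule generate.one)
  then have "\<exists>v\<in>power_subgroup G (carrier G) e. \<one> = v \<otimes> \<one>" by (intro bexI[of _ \<one>]) simp_all
  then show ?case by (intro exI[of _ "{\<one>}"]) (auto simp: generate_empty)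
next
  case (Cons a as)
  interpret central_ext G a as using Cons.prems by unfold_locales
  obtain F where F: "finite F" "card F \<le> e ^ length as" "F \<subseteq> carrier G"
    "\<And>x. x \<in> M \<Longrightarrow> \<exists>f\<in>F. \<exists>v\<in>power_subgroup G (carrier G) e. x = v \<otimes> f"
    using Cons.IH[OF cs_tail] by auto
  define V where "V = power_subgroup G (carrier G) e"
  have nV: "V \<lhd> G" unfolding V_def using power_subgroup_normal[OF normal_self] .
  have V: "subgroup V G" using normal_invE(1)[OF nV] .
  define F' where "F' = (\<lambda>(i, f). a [^] (i::nat) \<otimes> f) ` ({..<e} \<times> F)"
  have "card F' \<le> card ({..<e} \<times> F)" unfolding F'_def using F(1) by (intro card_image_le) simp
  also have "\<dots> \<le> e * e ^ length as" using F(2) by (simp add: card_cartesian_product)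
  finally have "card F' \<le> e ^ length (a # as)" by simp
  moreover have "finite F'" unfolding F'_def using F(1) by simp
  moreover have "F' \<subseteq> carrier G" unfolding F'_def using F(3) by auto
  moreover have "\<exists>f\<in>F'. \<exists>v\<in>V. x = v \<otimes> f" if x: "x \<in> N" for x
  proof -
    obtain n where "x \<in> ball G U n" using generate_in_ball[OF U_closed x] by blast
    then obtain j where j: "val x j" using ball_val by blast
    have xC: "x \<in> carrier G" using val_closed j .
    define i where "i = nat (j mod int e)"
    have i: "i < e" "int i = j mod int e" using \<open>e > 0\<close> unfolding i_def by (auto simp: nat_less_iff)
    define w where "w = (a [^] (j div int e)) [^] e"
    have wV: "w \<in> V" unfolding w_def V_def power_subgroup_def by (rule generate.incl) simp
    have wC: "w \<in> carrier G" using subgroup.mem_carrier[OF V wV] .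
    have aiC: "a [^] i \<in> carrier G" by simp
    have "val (inv (a [^] i) \<otimes> (inv w \<otimes> x)) (- (1 * int i) + (- (1 * (j div int e) * int e) + j))"
      unfolding w_def by (intro val_mult val_inv val_nat_pow val_int_pow val_gen j)
    moreover have "- (1 * int i) + (- (1 * (j div int e) * int e) + j) = 0"
      using i(2) by (simp add: minus_div_mult_eq_mod[symmetric])
    ultimately have "inv (a [^] i) \<otimes> (inv w \<otimes> x) \<in> M" using val_zero_iff by simp
    then obtain f v where f: "f \<in> F" and v: "v \<in> V" and eq: "inv (a [^] i) \<otimes> (inv w \<otimes> x) = v \<otimes> f"
      using F(4) unfolding V_def by blast
    have fC: "f \<in> carrier G" using f F(3) by blast
    have vC: "v \<in> carrier G" using subgroup.mem_carrier[OF V v] .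
    have "x = w \<otimes> (a [^] i \<otimes> (inv (a [^] i) \<otimes> (inv w \<otimes> x)))"
      using wC aiC xC by (simp add: inv_mult_cancel)
    also have "\<dots> = (w \<otimes> (a [^] i \<otimes> v \<otimes> inv (a [^] i))) \<otimes> (a [^] i \<otimes> f)"
      unfolding eq using wC aiC vC fC by (simp add: m_assoc inv_mult_cancel)
    finally have "x = (w \<otimes> (a [^] i \<otimes> v \<otimes> inv (a [^] i))) \<otimes> (a [^] i \<otimes> f)" .
    moreover have "w \<otimes> (a [^] i \<otimes> v \<otimes> inv (a [^] i)) \<in> V"
      using subgroup.m_closed[OF V wV normal_invE(2)[OF nV aiC v]] .
    moreover have "a [^] i \<otimes> f \<in> F'" unfolding F'_def using i(1) f by auto
    ultimately show ?thesis by blast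
  qed
  ultimately show ?case unfolding V_def by blast
qed

lemma (in group) D_sep_le_of_separated:
  assumes cs: "central_seq G as" and gen: "generate G (set as) = carrier G" and e: "e > 0"
    and H: "subgroup H G" and g: "g \<in> carrier G"
    and sep: "separated G (power_subgroup G (carrier G) e) H g"
  shows "D_sep G H g \<le> enat (e ^ length as)"
proof -
  define V where "V = power_subgroup G (carrier G) e"
  have nV: "V \<lhd> G" unfolding V_def using power_subgroup_normal[OF normal_self] .
  let ?Q = "G Mod V"
  define q where "q x = V #> x" for x
  interpret q: group_hom G ?Q q unfolding q_def using normal.quotient_hom[OF nV] .
  have q_one: "x \<in> carrier G \<Longrightarrow> q x = \<one>\<^bsub>?Q\<^esub> \<longleftrightarrow> x \<in> V" for x
    unfolding q_def using normal.quotient_eq_one_iff[OF nV] .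
  have VC: "V \<subseteq> carrier G" using subgroup.subset[OF normal_invE(1)[OF nV]] .
  obtain F where F: "finite F" "card F \<le> e ^ length as" "F \<subseteq> carrier G"
    "\<And>x. x \<in> carrier G \<Longrightarrow> \<exists>f\<in>F. \<exists>v\<in>V. x = v \<otimes> f"
    using power_subgroup_transversal[OF cs e] unfolding gen V_def by auto
  have sub: "carrier ?Q \<subseteq> q ` F"
  proof
    fix z assume "z \<in> carrier ?Q"
    then obtain x where x: "x \<in> carrier G" "z = q x" unfolding carrier_FactGroup q_def by blast
    obtain f v where fv: "f \<in> F" "v \<in> V" "x = v \<otimes> f" using F(4)[OF x(1)] by blast
    have vC: "v \<in> carrier G" and fC: "f \<in> carrier G" using fv VC F(3) by auto
    have "q v = \<one>\<^bsub>?Q\<^esub>" using q_one[OF vC] fv(2) by blast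
    then have "q x = q f" unfolding fv(3) by (simp only: q.hom_mult[OF vC fC] q.H.l_one[OF q.hom_closed[OF fC]])
    then show "z \<in> q ` F" using x(2) fv(1) by blast
  qed
  have fin: "finite (carrier ?Q)" using finite_subset[OF sub] F(1) by blast
  have "card (carrier ?Q) \<le> card (q ` F)" using sub F(1) by (intro card_mono) auto
  also have "\<dots> \<le> card F" using F(1) by (rule card_image_le)
  finally have card: "card (carrier ?Q) \<le> e ^ length as" using F(2) by simp
  have "q g \<notin> q ` H"
  proof
    assume "q g \<in> q ` H"
    then obtain h where h: "h \<in> H" "q g = q h" by blast
    have hC: "h \<in> carrier G" using subgroup.mem_carrier[OF H h(1)] .
    have "q (g \<otimes> inv h) = \<one>\<^bsub>?Q\<^esub>"
      by (simp only: q.hom_mult[OF g inv_closed[OF hC]] q.hom_inv[OF hC] h(2) q.H.r_inv[OF q.hom_closed[OF hC]])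
    then have "g \<otimes> inv h \<in> V" using q_one[of "g \<otimes> inv h"] g hC by blast
    moreover have "g = (g \<otimes> inv h) \<otimes> h" using g hC by (simp add: m_assoc)
    ultimately show False using sep h(1) unfolding separated_def V_def by blast
  qed
  then have "D_sep G H g \<le> enat (card (carrier ?Q))"
    using D_sep_le[OF is_group H g q.H.is_group fin q.homh] by blast
  also have "\<dots> \<le> enat (e ^ length as)" using card by simp
  finally show ?thesis .
qed

section \<open>Central sequences from the lower central series\<close>

context group begin

lemma commutator_flip:
  assumes "x \<in> carrier G" "y \<in> carrier G"
  shows "commutator G x y = inv (commutator G y x)"
  using assms by (simp add: commutator_def m_assoc inv_mult_group)

lemma lower_central_series_Suc:
  "lower_central_series G (Suc i) =
     generate G {commutator G x y | x y. x \<in> lower_central_series G i \<and> y \<in> carrier G}"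
  by (simp add: commutator_def)

lemma conj_commutator:
  assumes "x \<in> carrier G" "y \<in> carrier G" "g \<in> carrier G"
  shows "g \<otimes> commutator G x y \<otimes> inv g = commutator G (g \<otimes> x \<otimes> inv g) (g \<otimes> y \<otimes> inv g)"
  using assms by (simp add: commutator_def m_assoc inv_mult_group inv_mult_cancel)

lemma lower_central_series_normal: "lower_central_series G i \<lhd> G"
proof (induction i)
  case 0
  show ?case using normal_self by simp
next
  case (Suc i)
  let ?L = "lower_central_series G i"
  let ?C = "{commutator G x y | x y. x \<in> ?L \<and> y \<in> carrier G}"
  have LC: "?L \<subseteq> carrier G" using subgroup.subset[OF normal_invE(1)[OF Suc]] .
  then have C: "?C \<subseteq> carrier G" by auto
  have sub: "subgroup (generate G ?C) G" using generate_is_subgroup[OF C] .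
  have "g \<otimes> t \<otimes> inv g \<in> generate G ?C" if g: "g \<in> carrier G" and t: "t \<in> ?C" for g t
  proof -
    obtain x y where xy: "x \<in> ?L" "y \<in> carrier G" "t = commutator G x y" using t by blast
    then have "g \<otimes> t \<otimes> inv g = commutator G (g \<otimes> x \<otimes> inv g) (g \<otimes> y \<otimes> inv g)"
      using conj_commutator g LC by blast
    then have "g \<otimes> t \<otimes> inv g \<in> ?C" using normal_invE(2)[OF Suc g xy(1)] g xy(2) by blast
    then show ?thesis by (rule generate.incl)
  qed
  then have "g \<otimes> x \<otimes> inv g \<in> generate G ?C" if "g \<in> carrier G" "x \<in> generate G ?C" for g x
    using conj_generate[OF sub that(1) C _ that(2)] that(1) by blast
  then show ?case unfolding lower_central_series_Suc using sub normal_inv_iff by blast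
qed

lemma lower_central_series_subgroup: "subgroup (lower_central_series G i) G"
  using normal_invE(1)[OF lower_central_series_normal] .

lemma commutator_in_lower_central_series:
  "x \<in> lower_central_series G i \<Longrightarrow> y \<in> carrier G \<Longrightarrow>
    commutator G x y \<in> lower_central_series G (Suc i)"
  unfolding lower_central_series_Suc by (rule generate.incl) blast

lemma lower_central_series_Suc_subset: "lower_central_series G (Suc i) \<subseteq> lower_central_series G i"
proof -
  let ?L = "lower_central_series G i"
  have sub: "subgroup ?L G" by (rule lower_central_series_subgroup)
  have "commutator G x y \<in> ?L" if x: "x \<in> ?L" and y: "y \<in> carrier G" for x y
  proof -
    have xC: "x \<in> carrier G" using subgroup.mem_carrier[OF sub x] .
    have "commutator G x y = x \<otimes> (y \<otimes> inv x \<otimes> inv y)"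
      using xC y by (simp add: commutator_def m_assoc)
    then show ?thesis
      using subgroup.m_closed[OF sub x] normal_invE(2)[OF lower_central_series_normal y]
        subgroup.m_inv_closed[OF sub x] by metis
  qed
  then show ?thesis
    unfolding lower_central_series_Suc by (intro generate_subgroup_incl sub) blast
qed

lemma normal_between_lower_central_series:
  assumes K: "subgroup K G" and "lower_central_series G (Suc i) \<subseteq> K" "K \<subseteq> lower_central_series G i"
  shows "K \<lhd> G"
proof -
  have "g \<otimes> x \<otimes> inv g \<in> K" if g: "g \<in> carrier G" and x: "x \<in> K" for g x
  proof -
    have "inv (commutator G x g) \<in> K"
      using commutator_in_lower_central_series[of x i g] x g assms(2,3) subgroup.m_inv_closed[OF K] by blast
    then show ?thesis
      using conj_eq_commutator(2)[OF g subgroup.mem_carrier[OF K x]] subgroup.m_closed[OF K _ x] by simp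
  qed
  then show ?thesis using K normal_inv_iff by blast
qed

text \<open>
  Modulo the term two steps further, the commutator map from a term of the series and \<open>G\<close> to the
  next term is bimultiplicative, so the commutators of generators suffice.
\<close>

lemma lower_central_series_finitely_generated_mod_next:
  assumes S: "finite S" "S \<subseteq> carrier G" "generate G S = carrier G"
  shows "\<exists>B. finite B \<and> B \<subseteq> lower_central_series G i \<and>
    lower_central_series G i = generate G (B \<union> lower_central_series G (Suc i))"
proof (induction i)
  case 0
  have "lower_central_series G (Suc 0) \<subseteq> carrier G"
    using lower_central_series_Suc_subset[of 0] by simp
  then have "generate G (S \<union> lower_central_series G (Suc 0)) = carrier G"
    using S mono_generate[of S "S \<union> lower_central_series G (Suc 0)"]
      generate_in_carrier[of "S \<union> lower_central_series G (Suc 0)"] by blast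
  then show ?case using S by (intro exI[of _ S]) (simp del: lower_central_series.simps(2))
next
  case (Suc i)
  let ?L = "lower_central_series G"
  obtain B where B: "finite B" "B \<subseteq> ?L i" "?L i = generate G (B \<union> ?L (Suc i))"
    using Suc by blast
  define B' where "B' = (\<lambda>(b, s). commutator G b s) ` (B \<times> S)"
  define K where "K = generate G (B' \<union> ?L (Suc (Suc i)))"
  have LC: "?L k \<subseteq> carrier G" for k using subgroup.subset[OF lower_central_series_subgroup] .
  have B'L: "B' \<subseteq> ?L (Suc i)"
  proof
    fix x assume "x \<in> B'"
    then obtain b s where bs: "b \<in> B" "s \<in> S" "x = commutator G b s" unfolding B'_def by auto
    show "x \<in> ?L (Suc i)"
      unfolding bs(3) using bs(1,2) B(2) S(2) by (intro commutator_in_lower_central_series) auto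
  qed
  have gens: "B' \<union> ?L (Suc (Suc i)) \<subseteq> ?L (Suc i)"
    by (intro Un_least B'L lower_central_series_Suc_subset)
  have K: "subgroup K G"
    unfolding K_def by (rule generate_is_subgroup[OF subset_trans[OF gens LC]])
  have KL: "K \<subseteq> ?L (Suc i)"
    unfolding K_def by (rule generate_subgroup_incl[OF gens lower_central_series_subgroup])
  have LK: "?L (Suc (Suc i)) \<subseteq> K" unfolding K_def by (rule subsetI, rule generate.incl, rule UnI2)
  have nK: "K \<lhd> G" using normal_between_lower_central_series[OF K LK KL] .
  have K_flip: "commutator G x y \<in> K \<longleftrightarrow> commutator G y x \<in> K"
    if "x \<in> carrier G" "y \<in> carrier G" for x y
    using commutator_flip[OF that] commutator_flip[OF that(2,1)] subgroup.m_inv_closed[OF K] by metis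
  have bK: "commutator G b y \<in> K" if b: "b \<in> B" and y: "y \<in> carrier G" for b y
  proof -
    have bC: "b \<in> carrier G" using b B(2) LC by blast
    have "commutator G b s \<in> K" if "s \<in> S" for s
    proof -
      have "commutator G b s \<in> B'" unfolding B'_def using b that by auto
      then show ?thesis unfolding K_def by (blast intro: generate.incl)
    qed
    then have "S \<subseteq> {y \<in> carrier G. commutator G y b \<in> K}" using K_flip bC S(2) by blast
    then have "generate G S \<subseteq> {y \<in> carrier G. commutator G y b \<in> K}"
      using generate_subgroup_incl subgroup_commutator_in[OF nK bC] by blast
    then show ?thesis using K_flip bC y S(3) by blast
  qed
  have "commutator G x y \<in> K" if x: "x \<in> ?L i" and y: "y \<in> carrier G" for x y
  proof -
    have "B \<union> ?L (Suc i) \<subseteq> {x \<in> carrier G. commutator G x y \<in> K}"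
      using bK y B(2) LC commutator_in_lower_central_series[OF _ y] LK by blast
    then have "?L i \<subseteq> {x \<in> carrier G. commutator G x y \<in> K}"
      unfolding B(3) using generate_subgroup_incl subgroup_commutator_in[OF nK y] by blast
    then show ?thesis using x by blast
  qed
  then have "?L (Suc i) \<subseteq> K"
    unfolding lower_central_series_Suc[of i] by (intro generate_subgroup_incl K) blast
  then have "?L (Suc i) = K" using KL by blast
  moreover have "finite B'" unfolding B'_def using B(1) S(1) by simp
  ultimately show ?case using B'L unfolding K_def by blast
qed

lemma nilpotent_central_seq:
  assumes nil: "nilpotent_group G" and S: "finite S" "S \<subseteq> carrier G" "generate G S = carrier G"
  obtains as where "central_seq G as" "generate G (set as) = carrier G"
proof -
  let ?L = "lower_central_series G"
  obtain c where c: "?L c = {\<one>}" using nil unfolding nilpotent_group_def by blast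
  have LC: "?L k \<subseteq> carrier G" for k using subgroup.subset[OF lower_central_series_subgroup] .
  have "\<exists>as. central_seq G as \<and> generate G (set as) = ?L i" if "i \<le> c" for i
    using that
  proof (induction i rule: inc_induct)
    case base
    show ?case using c by (intro exI[of _ "[]"]) (simp add: generate_empty)
  next
    case (step i)
    obtain as where as: "central_seq G as" "generate G (set as) = ?L (Suc i)" using step.IH by blast
    obtain B where B: "finite B" "B \<subseteq> ?L i" "?L i = generate G (B \<union> ?L (Suc i))"
      using lower_central_series_finitely_generated_mod_next[OF S] by blast
    obtain xs where xs: "set xs = B" using finite_list[OF B(1)] by blast
    have "central_seq G (ys @ as)" if "set ys \<subseteq> ?L i" for ys
      using that
    proof (induction ys)
      case Nil
      show ?case using as(1) by simp
    next
      case (Cons y ys)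
      have "generate G (set as) \<subseteq> generate G (set (ys @ as))" by (rule mono_generate) auto
      then have "commutator G y g \<in> generate G (set (ys @ as))" if "g \<in> carrier G" for g
        using commutator_in_lower_central_series[of y i g] that Cons.prems as(2) by auto
      then show ?case using Cons LC by auto
    qed
    then have "central_seq G (xs @ as)" using xs B(2) by simp
    moreover have "generate G (set (xs @ as)) = ?L i"
    proof
      have "set as \<subseteq> ?L (Suc i)" unfolding as(2)[symmetric] by (blast intro: generate.incl)
      then have "set (xs @ as) \<subseteq> B \<union> ?L (Suc i)" using xs by auto
      then show "generate G (set (xs @ as)) \<subseteq> ?L i" unfolding B(3) by (rule mono_generate)
      have "?L (Suc i) \<subseteq> generate G (set (xs @ as))"
        unfolding as(2)[symmetric] by (rule mono_generate) auto
      moreover have "B \<subseteq> generate G (set (xs @ as))" using xs by (auto intro: generate.incl)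
      moreover have "subgroup (generate G (set (xs @ as))) G"
        using xs B(2) LC central_seq_carrier[OF as(1)] by (intro generate_is_subgroup) auto
      ultimately show "?L i \<subseteq> generate G (set (xs @ as))"
        unfolding B(3) by (intro generate_subgroup_incl) auto
    qed
    ultimately show ?case by blast
  qed
  from this[of 0] show ?thesis using that by auto
qed

section \<open>The upper bound\<close>

lemma Sub_polybounded:
  assumes nil: "nilpotent_group G" and S: "finite_generating_set G (carrier G) S"
  shows "\<exists>p. polybounded p \<and> (\<forall>n. Sub G S n \<le> enat (p n))"
proof -
  have S': "finite S" "S \<subseteq> carrier G" "generate G S = carrier G"
    using S unfolding finite_generating_set_def by auto
  obtain as where as: "central_seq G as" "generate G (set as) = carrier G"
    using nilpotent_central_seq[OF nil S'] by metis
  have asC: "set as \<subseteq> carrier G" using central_seq_carrier[OF as(1)] .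
  obtain c where c: "S \<subseteq> ball G (set as) c"
    using finite_subset_in_ball[OF asC S'(1)] S'(2) as(2) by auto
  obtain p where p: "polybounded p"
    "\<And>n X g. \<lbrakk>X \<subseteq> ball G (set as) n; g \<in> ball G (set as) n; g \<notin> generate G X\<rbrakk> \<Longrightarrow>
      \<exists>e>0. e \<le> p n \<and> separated G (power_subgroup G (carrier G) e) (generate G X) g"
    using separation_polybounded[OF as(1)] as(2) by auto
  have in_ball: "x \<in> ball G (set as) (n * c)" if "x \<in> carrier G" "word_length G S x \<le> n" for x n
    using ball_subst[OF asC c] word_length_le_iff[OF S'(2)] that S'(3) by blast
  have "D_sep G H g \<le> enat (p (n * c) ^ length as)"
    if H: "fg_subgroup G H" and g: "g \<in> carrier G - H"
      and lH: "subgroup_length G S H \<le> n" and lg: "word_length G S g \<le> n" for H g n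
  proof -
    define P where "P k \<longleftrightarrow> (\<exists>X. finite_generating_set G H X \<and> set_length G S X = k)" for k
    have "\<exists>k. P k" using H unfolding fg_subgroup_def P_def by blast
    then have "P (subgroup_length G S H)"
      unfolding subgroup_length_def P_def[symmetric] by (rule LeastI_ex)
    then obtain X where X: "finite_generating_set G H X" "set_length G S X \<le> n"
      using lH unfolding P_def by auto
    have X': "finite X" "X \<subseteq> carrier G" "generate G X = H"
      using X(1) unfolding finite_generating_set_def by auto
    have "word_length G S x \<le> n" if "x \<in> X" for x
      using X(2) X'(1) that unfolding set_length_def by auto
    then have "X \<subseteq> ball G (set as) (n * c)" using in_ball X'(2) by blast
    moreover have "g \<in> ball G (set as) (n * c)" using in_ball g lg by blast
    ultimately obtain e where e: "e > 0" "e \<le> p (n * c)"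
      "separated G (power_subgroup G (carrier G) e) H g"
      using p(2) g X'(3) by blast
    have "subgroup H G" using H unfolding fg_subgroup_def by blast
    then have "D_sep G H g \<le> enat (e ^ length as)"
      using D_sep_le_of_separated[OF as e(1) _ _ e(3)] g by blast
    also have "\<dots> \<le> enat (p (n * c) ^ length as)" using e(2) by (simp add: power_mono)
    finally show ?thesis .
  qed
  then have "Sub G S n \<le> enat (p (n * c) ^ length as)" for n
    unfolding Sub_def by (intro Sup_least) blast
  moreover have "polybounded (\<lambda>n. p (n * c) ^ length as)"
    by (intro polybounded_power polybounded_compose[OF p(1)] polybounded_intros)
  ultimately show ?thesis by blast
qed

section \<open>The lower bound\<close>

text \<open>
  If \<open>z\<close> is the image of \<open>s\<close> and \<open>d\<close> its order, the powers of \<open>z\<^bsup>2^(k+1)\<^esup>\<close> are those of \<open>z\<close> raised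
  to the greatest common divisor of \<open>d\<close> and \<open>2^(k+1)\<close>. Unless \<open>2^(k+1)\<close> divides \<open>d\<close>, this
  greatest common divisor divides \<open>2^k\<close>, and the image of the subgroup contains \<open>z\<^bsup>2^k\<^esup>\<close>.
\<close>

lemma two_power_le_D_sep:
  assumes s: "s \<in> carrier G"
  shows "enat (2 ^ Suc k) \<le> D_sep G (generate G {s [^] (2 ^ Suc k :: nat)}) (s [^] (2 ^ k :: nat))"
  unfolding D_sep_def
proof (intro Inf_greatest, elim CollectE exE conjE bexE)
  fix D Q \<pi>
  assume D: "D = enat (card (carrier Q))" and Q: "group Q" "finite (carrier (Q :: nat monoid))"
    and \<pi>: "\<pi> \<in> hom G Q"
    and sep: "\<pi> (s [^] (2 ^ k :: nat)) \<notin> \<pi> ` generate G {s [^] (2 ^ Suc k :: nat)}"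
  interpret \<pi>: group_hom G Q \<pi> using Q(1) \<pi> is_group by (simp add: group_hom_def group_hom_axioms_def)
  define d where "d = \<pi>.H.ord (\<pi> s)"
  have z: "\<pi> s \<in> carrier Q" using s by simp
  have "2 ^ Suc k dvd d"
  proof (rule ccontr)
    assume nd: "\<not> 2 ^ Suc k dvd d"
    have "gcd d (2 ^ Suc k) dvd 2 ^ Suc k" by simp
    then obtain i where i: "i \<le> Suc k" "gcd d (2 ^ Suc k) = 2 ^ i"
      using divides_primepow_nat[of 2] two_is_prime_nat by blast
    have "i \<noteq> Suc k" using nd i(2) gcd_dvd1[of d "2 ^ Suc k"] by auto
    then have "gcd d (2 ^ Suc k) dvd 2 ^ k" using i by (simp add: le_imp_power_dvd)
    then have "gcd (int d) (2 ^ Suc k) dvd 2 ^ k"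
      by (metis gcd_int_int_eq int_dvd_int_iff of_nat_numeral of_nat_power)
    then obtain q where q: "2 ^ k = gcd (int d) (2 ^ Suc k) * q" by blast
    obtain x y where "x * int d + y * 2 ^ Suc k = gcd (int d) (2 ^ Suc k)" using bezout_int by blast
    with q have "(2::int) ^ k = (x * int d + y * 2 ^ Suc k) * q" by (simp only:)
    then have eq: "(2::int) ^ k = int d * (x * q) + 2 ^ Suc k * (y * q)"
      by (simp add: algebra_simps)
    then have "2 ^ Suc k * (y * q) - 2 ^ k = int d * - (x * q)"
      by (simp only: mult_minus_right)
    then have cong: "int d dvd 2 ^ Suc k * (y * q) - 2 ^ k" by (simp only: dvd_triv_left)
    let ?t = "(s [^] (2 ^ Suc k :: nat)) [^] (y * q)"
    have "\<pi> (s [^] (2 ^ k :: nat)) = \<pi> s [^]\<^bsub>Q\<^esub> ((2::int) ^ k)"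
      using \<pi>.hom_int_pow[OF s, of "int (2 ^ k)"] int_pow_int[of G s "2 ^ k"] by simp
    also have "\<dots> = \<pi> s [^]\<^bsub>Q\<^esub> (2 ^ Suc k * (y * q))"
      using \<pi>.H.int_pow_eq[OF z] cong unfolding d_def by blast
    also have "\<dots> = \<pi> (s [^] (int (2 ^ Suc k) * (y * q)))" using \<pi>.hom_int_pow[OF s] by simp
    also have "s [^] (int (2 ^ Suc k) * (y * q)) = ?t"
      using int_pow_pow[OF s, of "int (2 ^ Suc k)" "y * q"] by (simp only: int_pow_int)
    finally have "\<pi> (s [^] (2 ^ k :: nat)) = \<pi> ?t" .
    moreover have "?t \<in> generate G {s [^] (2 ^ Suc k :: nat)}"
      using generate_pow[OF nat_pow_closed[OF s]] by blast
    ultimately show False using sep by blast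
  qed
  moreover have "d > 0" "d \<le> card (carrier Q)"
    unfolding d_def using \<pi>.H.ord_ge_1[OF Q(2) z] \<pi>.H.ord_le_group_order[OF Q(2) z]
    by (simp_all add: order_def)
  ultimately have "2 ^ Suc k \<le> card (carrier Q)" using dvd_imp_le le_trans by blast
  then show "enat (2 ^ Suc k) \<le> D" using D by simp
qed

lemma Sub_linear_lower_bound:
  assumes tf: "torsion_free G" and nontrivial: "carrier G \<noteq> {\<one>}"
    and S: "finite_generating_set G (carrier G) S"
  shows "(\<lambda>n. enat n) \<preceq> Sub G S"
proof -
  have S': "S \<subseteq> carrier G" "generate G S = carrier G"
    using S unfolding finite_generating_set_def by auto
  obtain s where s: "s \<in> carrier G" "s \<noteq> \<one>" using nontrivial one_closed by blast
  have "ord s = 0"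
    using tf s pow_ord_eq_1[OF s(1)] unfolding torsion_free_def by (meson neq0_conv)
  then have inj: "i = j" if "s [^] i = s [^] j" for i j :: int
    using int_pow_eq[OF s(1), of i j] that by simp
  obtain l where l: "s \<in> ball G S l" using generate_in_ball[OF S'(1)] S'(2) s(1) by blast
  have wl: "word_length G S (s [^] m) \<le> m * l" for m :: nat
    using word_length_le_iff[OF S'(1)] S'(2) ball_nat_pow[OF S'(1) l] s(1) by simp
  define C where "C = 2 * l + 1"
  have "enat n \<le> enat C * Sub G S (C * n)" if n: "n \<ge> 1" for n
  proof -
    obtain k where k: "2 ^ k \<le> n" "n < 2 ^ (k + 1)" using ex_power_ivl1[of 2 n] n by auto
    define h where "h = s [^] (2 ^ Suc k :: nat)"
    define H where "H = generate G {h}"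
    define g where "g = s [^] (2 ^ k :: nat)"
    have hC: "h \<in> carrier G" unfolding h_def using s(1) by simp
    have gen: "finite_generating_set G H {h}" unfolding finite_generating_set_def H_def using hC by simp
    have fg: "fg_subgroup G H"
      unfolding fg_subgroup_def using gen generate_is_subgroup[of "{h}"] hC unfolding H_def by blast
    have "g \<notin> H"
    proof
      assume "g \<in> H"
      then obtain j :: int where "g = h [^] j" unfolding H_def using generate_pow[OF hC] by blast
      then have "s [^] int (2 ^ k) = s [^] (int (2 ^ Suc k) * j)"
        unfolding g_def h_def using int_pow_pow[OF s(1), of "int (2 ^ Suc k)" j] by (simp only: int_pow_int)
      then have "(2::int) ^ k = 2 ^ k * (2 * j)" using inj by fastforce
      then have "2 * j = 1" by simp
      then show False by presburger
    qed
    then have gH: "g \<in> carrier G - H" unfolding g_def using s(1) by simp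
    have "2 ^ Suc k * l \<le> C * n"
    proof -
      have "2 ^ Suc k * l \<le> (2 * n) * l" using k(1) by (intro mult_le_mono1) simp
      also have "\<dots> \<le> C * n" unfolding C_def by (simp add: algebra_simps)
      finally show ?thesis .
    qed
    moreover have "2 ^ k * l \<le> 2 ^ Suc k * l" by (intro mult_le_mono1) simp
    ultimately have len: "word_length G S h \<le> C * n" "word_length G S g \<le> C * n"
      using wl[of "2 ^ Suc k"] wl[of "2 ^ k"] unfolding h_def g_def by linarith+
    have "subgroup_length G S H \<le> set_length G S {h}"
      unfolding subgroup_length_def using gen by (intro Least_le) blast
    also have "\<dots> \<le> C * n" unfolding set_length_def using len(1) by simp
    finally have lenH: "subgroup_length G S H \<le> C * n" .
    have "enat n \<le> enat (2 ^ Suc k)" using k(2) by simp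
    also have "\<dots> \<le> D_sep G H g" unfolding H_def h_def g_def by (rule two_power_le_D_sep[OF s(1)])
    also have "\<dots> \<le> Sub G S (C * n)"
      unfolding Sub_def using fg gH lenH len(2) by (intro Sup_upper) blast
    also have "\<dots> = enat 1 * Sub G S (C * n)" by (simp only: one_enat_def[symmetric] mult_1)
    also have "\<dots> \<le> enat C * Sub G S (C * n)" by (intro mult_right_mono) (simp_all add: C_def)
    finally show ?thesis .
  qed
  then show ?thesis unfolding growth_le_def by (intro exI[of _ C]) (simp add: C_def)
qed

end

lemma growth_le_power_of_polybounded:
  assumes "polybounded p" and "\<And>n. f n \<le> enat (p n)"
  shows "\<exists>k\<ge>1. f \<preceq> (\<lambda>n. enat (n ^ k))"
proof -
  obtain C k where p: "\<And>n. p n \<le> C * (n + 1) ^ k" using assms(1) polybounded_def by auto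
  define D where "D = C + 2"
  have "f n \<le> enat D * enat ((D * n) ^ Suc k)" if n: "n \<ge> 1" for n
  proof -
    have "p n \<le> C * (n + 1) ^ k" by (rule p)
    also have "\<dots> \<le> D * (D * n) ^ k"
    proof (intro mult_le_mono power_mono)
      have "n + 1 \<le> 2 * n" using n by simp
      also have "\<dots> \<le> D * n" unfolding D_def by simp
      finally show "n + 1 \<le> D * n" .
    qed (simp_all add: D_def)
    also have "\<dots> \<le> D * (D * n) ^ Suc k"
      using n by (intro mult_le_mono2 power_increasing) (simp_all add: D_def)
    finally show ?thesis using assms(2)[of n] by (simp add: order_trans)
  qed
  then show ?thesis
    unfolding growth_le_def by (intro exI[of _ "Suc k"] conjI exI[of _ D]) (simp_all add: D_def)
qed

theorem theorem1p3:
  fixes N :: "('a, 'b) monoid_scheme" and S :: "'a set"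
  assumes "group N" and "carrier N \<noteq> {\<one>\<^bsub>N\<^esub>}"
    and "torsion_free N" and "nilpotent_group N"
    and "finite_generating_set N (carrier N) S"
  shows "\<exists>k\<ge>1. (\<lambda>n. enat n) \<preceq> Sub N S \<and> Sub N S \<preceq> (\<lambda>n. enat (n ^ k))"
proof -
  obtain p where "polybounded p" "\<And>n. Sub N S n \<le> enat (p n)"
    using group.Sub_polybounded[OF assms(1,4,5)] by auto
  then have "\<exists>k\<ge>1. Sub N S \<preceq> (\<lambda>n. enat (n ^ k))"
    by (rule growth_le_power_of_polybounded)
  then show ?thesis using group.Sub_linear_lower_bound[OF assms(1,3,2,5)] by blast
qed

end
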